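(* (a) In $Q_3^n$ there is only one, up to equivalence, unitrade $B$ of the maximum cardinality $2\cdot 3^{n-1}$; it is a bitrade and can be given by the equality $$B=\{x\in Q_3^n : x_1+\dots+x_n\not\equiv 0 \pmod 3\}=U[\ell],\qquad \ell(x_1,\dots,x_n)=\bigoplus_{i<j}x_ix_j.$$ (b) For $n\ge 3$, in $Q_3^n$ there are bitrades of cardinality $14\cdot 3^{n-3}$. (c) For $n\ge 3$, in $Q_3^n$ there are no bitrades of cardinality strictly between $14\cdot 3^{n-3}$ and $2\cdot 3^{n-1}$.
   Context: $Q_2=\{0,1\}$ and $Q_3=\{0,1,2\}$ (equivalently $\{0,1,-1\}$ with $2=-1$, identified with the integers modulo $3$). A one-dimensional face of $Q_3^n$ is a set of $3$ words obtained by fixing the values of all coordinates but one. A unitrade is a set $U\subset Q_3^n$ whose intersection with every one-dimensional face has cardinality $0$ or $2$. The Hamming graph on $Q_3^n$ joins two words when they differ in exactly one coordinate. A bitrade is a unitrade $U$ such that the subgraph of the Hamming graph induced by $U$ is bipartite. Two subsets of $Q_3^n$ are equivalent if one is mapped to the other by an isometry of $Q_3^n$ (with the Hamming distance), i.e. by a composition of a permutation of coordinates and permutations of the alphabet $Q_3$ in each coordinate. The symbol $\oplus$ denotes addition modulo $2$. Define a partial order $\preceq$ on $Q_3$ in which $2$ is the greatest element and $0$, $1$ are incomparable; extend it to $Q_3^n$ coordinatewise, so that $(x_1,\dots,x_n)\preceq(y_1,\dots,y_n)$ if $x_i\preceq y_i$ for all $i$. For a Boolean function $f:Q_2^n\to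 Q_2$, $U[f]$ denotes the unitrade in $Q_3^n$ with characteristic function $U[f](y)=\bigoplus_{x\in Q_2^n,\ x\preceq y} f(x)$, $y\in Q_3^n$ (the unitrade and its characteristic function are denoted by the same symbol); this is the unique unitrade whose characteristic function restricted to $Q_2^n=\{0,1\}^n$ equals $f$.
   Formalization: The printed formula for ℓ is false for every n ≥ 1 (it vanishes at (1,0,…,0), which lies in B); in the equality B = U[ℓ] it is replaced by the sum modulo 2 of all square-free monomials whose degree is not divisible by 3. *)

theory Defs
  imports Complex_Main "HOL-Library.FuncSet"
begin

text \<open>A word of length \<open>n\<close> is a function on \<open>{..<n}\<close> (coordinates are numbered from \<open>0\<close>), extended
  by \<open>undefined\<close>, so that equality of words is equality of HOL functions.\<close>

definition Q :: "nat \<Rightarrow> nat \<Rightarrow> (nat \<Rightarrow> nat) set" where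
  "Q q n = {..<n} \<rightarrow>\<^sub>E {..<q}"

definition one_dim_face :: "nat \<Rightarrow> (nat \<Rightarrow> nat) set \<Rightarrow> bool" where
  "one_dim_face n F \<longleftrightarrow>
     (\<exists>i<n. \<exists>x\<in>Q 3 n. F = {y \<in> Q 3 n. \<forall>j<n. j \<noteq> i \<longrightarrow> y j = x j})"

definition unitrade :: "nat \<Rightarrow> (nat \<Rightarrow> nat) set \<Rightarrow> bool" where
  "unitrade n U \<longleftrightarrow> U \<subseteq> Q 3 n \<and> (\<forall>F. one_dim_face n F \<longrightarrow> card (U \<inter> F) \<in> {0, 2})"

definition hamming_dist :: "nat \<Rightarrow> (nat \<Rightarrow> nat) \<Rightarrow> (nat \<Rightarrow> nat) \<Rightarrow> nat" where
  "hamming_dist n x y = card {i. i < n \<and> x i \<noteq> y i}"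

definition hamming_adj :: "nat \<Rightarrow> (nat \<Rightarrow> nat) \<Rightarrow> (nat \<Rightarrow> nat) \<Rightarrow> bool" where
  "hamming_adj n x y \<longleftrightarrow> hamming_dist n x y = 1"

definition induces_bipartite :: "nat \<Rightarrow> (nat \<Rightarrow> nat) set \<Rightarrow> bool" where
  "induces_bipartite n U \<longleftrightarrow>
     (\<exists>V W. V \<union> W = U \<and> V \<inter> W = {} \<and>
        (\<forall>x\<in>V. \<forall>y\<in>V. \<not> hamming_adj n x y) \<and> (\<forall>x\<in>W. \<forall>y\<in>W. \<not> hamming_adj n x y))"

definition bitrade :: "nat \<Rightarrow> (nat \<Rightarrow> nat) set \<Rightarrow> bool" where
  "bitrade n U \<longleftrightarrow> unitrade n U \<and> induces_bipartite n U"

definition hamming_isometry :: "nat \<Rightarrow> ((nat \<Rightarrow> nat) \<Rightarrow> (nat \<Rightarrow> nat)) \<Rightarrow> bool" where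
  "hamming_isometry n \<phi> \<longleftrightarrow> bij_betw \<phi> (Q 3 n) (Q 3 n) \<and>
     (\<forall>x\<in>Q 3 n. \<forall>y\<in>Q 3 n. hamming_dist n (\<phi> x) (\<phi> y) = hamming_dist n x y)"

definition equivalent :: "nat \<Rightarrow> (nat \<Rightarrow> nat) set \<Rightarrow> (nat \<Rightarrow> nat) set \<Rightarrow> bool" where
  "equivalent n U V \<longleftrightarrow> (\<exists>\<phi>. hamming_isometry n \<phi> \<and> \<phi> ` U = V)"

definition preceq :: "nat \<Rightarrow> nat \<Rightarrow> bool" where
  "preceq a b \<longleftrightarrow> a = b \<or> b = 2"

definition preceq_word :: "nat \<Rightarrow> (nat \<Rightarrow> nat) \<Rightarrow> (nat \<Rightarrow> nat) \<Rightarrow> bool" where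
  "preceq_word n x y \<longleftrightarrow> (\<forall>i<n. preceq (x i) (y i))"

text \<open>A Boolean function \<open>f\<close> is given by its values in \<open>{0, 1}\<close> on \<open>Q 2 n\<close>; \<open>U_of n f\<close> is \<open>U[f]\<close>.\<close>

definition U_of :: "nat \<Rightarrow> ((nat \<Rightarrow> nat) \<Rightarrow> nat) \<Rightarrow> (nat \<Rightarrow> nat) set" where
  "U_of n f = {y \<in> Q 3 n. (\<Sum>x | x \<in> Q 2 n \<and> preceq_word n x y. f x) mod 2 = 1}"

text \<open>The Boolean function whose Zhegalkin polynomial consists of all square-free monomials of
  degree not divisible by \<open>3\<close>. The quadratic form \<open>\<Oplus>\<^sub>i\<^sub><\<^sub>j x\<^sub>i x\<^sub>j\<close>, which appears in print in its place,
  does not represent the maximum unitrade for any \<open>n \<ge> 1\<close>: it vanishes at \<open>(1, 0, \<dots>, 0)\<close>, whose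
  coordinate sum is \<open>1\<close>.\<close>

definition ell :: "nat \<Rightarrow> (nat \<Rightarrow> nat) \<Rightarrow> nat" where
  "ell n x = (\<Sum>S | S \<subseteq> {..<n} \<and> card S mod 3 \<noteq> 0. \<Prod>i\<in>S. x i) mod 2"

end

(*
  A unitrade of maximum size is the complement of a Latin hypercube P (a set meeting every line
  exactly once), and Latin hypercubes over three letters are affine; this gives (a).  For the gap,
  averaging and induction on n provide, in a bitrade larger than 14 * 3^(n-3), a layer of maximum
  size in the last direction.  Let P be its complement, and let S be the set of those points of P
  whose line in the last direction meets U; then |U| = 2 * (2 * 3^(n-2) + |S|).  A walk of length 7
  shows that if two of the three points of P in a two-dimensional face belong to S, so does the
  third.  By induction on the dimension such a set S is either P or has at most |P|/3 points: if one
  layer of S is that of P and another is nonempty, the other two layers together form a unitrade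
  inside a maximum unitrade, which has no proper nonempty subunitrade.
*)
theory Submission
  imports Defs
begin

section \<open>Words, lines and layers\<close>

text \<open>The constant 14 is the density bound read off from the cardinality formula. In dimension
  n >= 3 the set P has 3^(n-2) points, so |S| <= |P|/3 gives |U| <= 2 * (2 * 3^(n-2) + 3^(n-3)) = 14
  * 3^(n-3), while S = P gives the maximum. The example of size 14 in dimension 3 attains the bound:
  there P = {00, 12, 21} and S = {00}. Bipartiteness enters the gap argument only by excluding the
  odd closed walk; the rest is parity on lines. Affinity of Latin hypercubes is special to three
  letters: every permutation of the integers modulo 3 is affine. The equality with U[ell] is tested
  on Boolean words only, since they determine a unitrade. At a word with w ones, \<open>ell\<close>
  counts modulo 2 the subsets of a w-set whose size is not divisible by 3. The parities come from
  the powers (1 + X)^w in GF(2)[X]/(X^3 - 1), which have period 3 from w = 1 on.\<close>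

lemma less_3_iff: "a < 3 \<longleftrightarrow> a \<in> {0, 1, 2::nat}"
  by auto

lemma Q_upd: "x \<in> Q q n \<Longrightarrow> i < n \<Longrightarrow> a < q \<Longrightarrow> x(i := a) \<in> Q q n"
  by (auto simp: Q_def PiE_iff extensional_def)

lemma Q_upd_last: "x \<in> Q q n \<Longrightarrow> a < q \<Longrightarrow> x(n := a) \<in> Q q (Suc n)"
  by (auto simp: Q_def PiE_iff extensional_def)

lemma Q_less: "x \<in> Q q n \<Longrightarrow> i < n \<Longrightarrow> x i < q"
  by (auto simp: Q_def PiE_iff)

lemma Q_eqI: "x \<in> Q q n \<Longrightarrow> y \<in> Q q n \<Longrightarrow> (\<And>i. i < n \<Longrightarrow> x i = y i) \<Longrightarrow> x = y"
  unfolding Q_def by (rule PiE_ext) auto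

lemma Q_mono: "q \<le> r \<Longrightarrow> Q q n \<subseteq> Q r n"
  unfolding Q_def by (rule PiE_mono) auto

lemma Q_SucE:
  assumes "x \<in> Q q (Suc n)"
  obtains y a where "y \<in> Q q n" "a < q" "x = y(n := a)"
proof
  show "x(n := undefined) \<in> Q q n" "x n < q" "x = (x(n := undefined))(n := x n)"
    using assms by (auto simp: Q_def PiE_iff extensional_def)
qed

lemma finite_Q [simp]: "finite (Q q n)"
  by (simp add: Q_def finite_PiE)

lemma card_Q [simp]: "card (Q q n) = q ^ n"
  by (simp add: Q_def card_PiE)

lemma Q_0: "Q q 0 = {\<lambda>_. undefined}"
  by (simp add: Q_def)

lemma bij_betw_Q_Suc:
  "bij_betw (\<lambda>(x, a). x(n := a)) (Q q n \<times> {..<q}) (Q q (Suc n))"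
proof (rule bij_betwI')
  fix u v assume "u \<in> Q q n \<times> {..<q}" "v \<in> Q q n \<times> {..<q}"
  moreover have "x = y \<and> a = b"
    if "x \<in> Q q n" "y \<in> Q q n" "x(n := a) = y(n := b)" for x y a b
  proof
    show "a = b" using that(3) by (metis fun_upd_same)
    show "x = y"
      using that by (intro Q_eqI[of x q n y]) (auto dest: fun_cong simp: fun_eq_iff split: if_splits)
  qed
  ultimately show "((\<lambda>(x, a). x(n := a)) u = (\<lambda>(x, a). x(n := a)) v) = (u = v)"
    by (auto simp del: fun_upd_apply)
qed (auto intro: Q_upd_last elim!: Q_SucE)

lemma sum_Q_Suc:
  "(\<Sum>x\<in>Q q (Suc n). g x) = (\<Sum>x\<in>Q q n. \<Sum>a<q. g (x(n := a)) :: 'a::comm_monoid_add)"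
  by (subst sum.reindex_bij_betw[OF bij_betw_Q_Suc, symmetric])
     (simp add: sum.cartesian_product split_def)

lemma card_conv_sum:
  assumes "U \<subseteq> Q q n"
  shows "card U = (\<Sum>x\<in>Q q n. of_bool (x \<in> U))"
proof -
  have "Q q n \<inter> U = U" using assms by blast
  then show ?thesis by (simp add: of_bool_def sum.If_cases)
qed

text \<open>For \<open>x\<close> in \<open>Q 3 n\<close> the value at \<open>n\<close> is the
  default \<open>undefined\<close>, so the update appends a letter. A layer is thus again a set of
  words of the shorter length, ready for induction on the dimension.\<close>

definition layer :: "nat \<Rightarrow> (nat \<Rightarrow> nat) set \<Rightarrow> nat \<Rightarrow> (nat \<Rightarrow> nat) set" where
  "layer n U t = {x \<in> Q 3 n. x(n := t) \<in> U}"

lemma layer_subset: "layer n U t \<subseteq> Q 3 n"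
  by (auto simp: layer_def)

lemma mem_layer [simp]: "x \<in> layer n U t \<longleftrightarrow> x \<in> Q 3 n \<and> x(n := t) \<in> U"
  by (simp add: layer_def)

lemma finite_layer [simp]: "finite (layer n U t)"
  using finite_subset[OF layer_subset] by simp

lemma sum_less_3: "(\<Sum>a<3::nat. g a) = g 0 + g 1 + (g 2 :: 'a::comm_monoid_add)"
  by (simp add: numeral_3_eq_3 numeral_2_eq_2)

lemma card_layers:
  assumes "U \<subseteq> Q 3 (Suc n)"
  shows "card U = card (layer n U 0) + card (layer n U 1) + card (layer n U 2)"
proof -
  have "card U = (\<Sum>x\<in>Q 3 n. \<Sum>a<3. of_bool (x(n := a) \<in> U))"
    by (simp add: card_conv_sum[OF assms] sum_Q_Suc)
  also have "\<dots> = (\<Sum>a<3. \<Sum>x\<in>Q 3 n. of_bool (x(n := a) \<in> U))"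
    by (rule sum.swap)
  also have "\<dots> = (\<Sum>a<3. card (layer n U a))"
    by (intro sum.cong refl) (auto simp: card_conv_sum[OF layer_subset] intro!: sum.cong)
  finally show ?thesis by (simp only: sum_less_3)
qed

section \<open>Lines and the parity condition for unitrades\<close>

lemma one_dim_face_iff:
  "one_dim_face n F \<longleftrightarrow> (\<exists>i<n. \<exists>x\<in>Q 3 n. F = {x(i := 0), x(i := 1), x(i := 2)})"
proof -
  have "{y \<in> Q 3 n. \<forall>j<n. j \<noteq> i \<longrightarrow> y j = x j} = {x(i := 0), x(i := 1), x(i := 2)}"
    if "i < n" "x \<in> Q 3 n" for i x
  proof (intro equalityI subsetI)
    fix y assume y: "y \<in> {y \<in> Q 3 n. \<forall>j<n. j \<noteq> i \<longrightarrow> y j = x j}"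
    have "y = x(i := y i)"
      using y that by (intro Q_eqI[of y 3 n] Q_upd) (auto intro: Q_less)
    moreover have "y i \<in> {0, 1, 2}" using y that Q_less[of y 3 n i] by auto
    ultimately show "y \<in> {x(i := 0), x(i := 1), x(i := 2)}" by auto
  qed (use that in \<open>auto intro!: Q_upd\<close>)
  then show ?thesis unfolding one_dim_face_def by (metis (no_types, lifting))
qed

lemma fun_upd_eq_iff: "x(i := a) = x(i := b) \<longleftrightarrow> a = b"
  by (metis fun_upd_same)

text \<open>The even numbers up to three are 0 and 2, so the cardinality condition on a line is a
  linear condition over GF(2): membership at one letter is the exclusive or of the other
  two.\<close>

lemma unitrade_iff:
  "unitrade n U \<longleftrightarrow> U \<subseteq> Q 3 n \<and>
     (\<forall>x\<in>Q 3 n. \<forall>i<n. x(i := 2) \<in> U \<longleftrightarrow> (x(i := 0) \<in> U) \<noteq> (x(i := 1) \<in> U))"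
proof -
  have "card (U \<inter> {x(i := 0), x(i := 1), x(i := 2)}) \<in> {0, 2} \<longleftrightarrow>
     (x(i := 2) \<in> U \<longleftrightarrow> (x(i := 0) \<in> U) \<noteq> (x(i := 1) \<in> U))" for x i
    by (auto simp: Int_insert_right card_insert_if fun_upd_eq_iff simp del: fun_upd_apply)
  then show ?thesis
    unfolding unitrade_def one_dim_face_iff by (metis (no_types, lifting))
qed

lemma unitrade_subset: "unitrade n U \<Longrightarrow> U \<subseteq> Q 3 n"
  by (simp add: unitrade_def)

lemma unitrade_line:
  assumes "unitrade n U" "x \<in> Q 3 n" "i < n"
    and "a < 3" "b < 3" "c < 3" "a \<noteq> b" "a \<noteq> c" "b \<noteq> c"
  shows "x(i := a) \<in> U \<longleftrightarrow> (x(i := b) \<in> U) \<noteq> (x(i := c) \<in> U)"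
proof -
  have "x(i := 2) \<in> U \<longleftrightarrow> (x(i := 0) \<in> U) \<noteq> (x(i := 1) \<in> U)"
    using assms(1-3) by (auto simp: unitrade_iff)
  then show ?thesis using assms(4-) unfolding less_3_iff by (elim insertE emptyE; simp) blast+
qed

lemma unitrade_layer:
  assumes "unitrade (Suc n) U" "t < 3"
  shows "unitrade n (layer n U t)"
  unfolding unitrade_iff
proof (intro conjI ballI allI impI)
  fix x i assume x: "x \<in> Q 3 n" "i < n"
  then have "x(n := t) \<in> Q 3 (Suc n)" using assms by (intro Q_upd_last)
  then have "x(n := t, i := 2) \<in> U \<longleftrightarrow> (x(n := t, i := 0) \<in> U) \<noteq> (x(n := t, i := 1) \<in> U)"
    using assms x by (auto simp: unitrade_iff)
  then show "x(i := 2) \<in> layer n U t \<longleftrightarrow> (x(i := 0) \<in> layer n U t) \<noteq> (x(i := 1) \<in> layer n U t)"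
    using x by (simp add: Q_upd fun_upd_twist[of i n] del: fun_upd_apply)
qed (rule layer_subset)

text \<open>In positive dimension this characterises the unitrades of maximum size. Unlike an
  equation between cardinalities it passes to layers at once.\<close>

definition meets_lines :: "nat \<Rightarrow> (nat \<Rightarrow> nat) set \<Rightarrow> bool" where
  "meets_lines n U \<longleftrightarrow> (\<forall>x\<in>Q 3 n. \<forall>i<n. \<exists>a<3. x(i := a) \<in> U)"

definition shadow :: "nat \<Rightarrow> (nat \<Rightarrow> nat) set \<Rightarrow> (nat \<Rightarrow> nat) set" where
  "shadow n U = {x \<in> Q 3 n. \<exists>a<3. x(n := a) \<in> U}"

text \<open>Each line in the last direction that meets \<open>U\<close> contributes exactly two
  points, and such lines correspond to the points of the shadow.\<close>

lemma card_unitrade_shadow: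
  assumes "unitrade (Suc n) U"
  shows "card U = 2 * card (shadow n U)"
proof -
  have "(\<Sum>a<3. of_bool (x(n := a) \<in> U)) = 2 * (of_bool (x \<in> shadow n U) :: nat)"
    if "x \<in> Q 3 n" for x
  proof -
    have "x(n := 0) \<in> Q 3 (Suc n)" using that by (intro Q_upd_last) auto
    then have "x(n := 2) \<in> U \<longleftrightarrow> (x(n := 0) \<in> U) \<noteq> (x(n := 1) \<in> U)"
      using unitrade_line[OF assms, of "x(n := 0)" n 2 0 1] by simp
    then show ?thesis
      using that by (auto simp: sum_less_3 shadow_def less_3_iff simp del: fun_upd_apply)
  qed
  then have "(\<Sum>x\<in>Q 3 n. \<Sum>a<3. of_bool (x(n := a) \<in> U)) =
      (\<Sum>x\<in>Q 3 n. 2 * (of_bool (x \<in> shadow n U) :: nat))"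
    by (intro sum.cong refl)
  moreover have "shadow n U \<subseteq> Q 3 n" by (auto simp: shadow_def)
  ultimately show ?thesis
    using card_conv_sum[OF unitrade_subset[OF assms]] card_conv_sum[of "shadow n U" 3 n]
    by (simp only: sum_Q_Suc sum_distrib_left[symmetric])
qed

lemma card_unitrade_le:
  assumes "unitrade (Suc n) U"
  shows "card U \<le> 2 * 3 ^ n"
proof -
  have "card (shadow n U) \<le> card (Q 3 n)"
    by (rule card_mono) (auto simp: shadow_def)
  then show ?thesis using card_unitrade_shadow[OF assms] by simp
qed

lemma meets_lines_layer:
  assumes "meets_lines (Suc n) U" "t < 3"
  shows "meets_lines n (layer n U t)"
  unfolding meets_lines_def
proof (intro ballI allI impI)
  fix x i assume x: "x \<in> Q 3 n" "i < n"
  then have "x(n := t) \<in> Q 3 (Suc n)" using assms by (intro Q_upd_last)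
  then obtain a where "a < 3" "x(n := t, i := a) \<in> U"
    using assms x by (auto simp: meets_lines_def) (metis less_SucI)
  then show "\<exists>a<3. x(i := a) \<in> layer n U t"
    using x by (auto simp add: Q_upd fun_upd_twist[of i n] simp del: fun_upd_apply)
qed

lemma shadow_meets_lines: "meets_lines (Suc n) U \<Longrightarrow> shadow n U = Q 3 n"
proof (intro equalityI subsetI)
  fix x assume *: "meets_lines (Suc n) U" "x \<in> Q 3 n"
  then have "x(n := 0) \<in> Q 3 (Suc n)" by (intro Q_upd_last) auto
  then obtain a where "a < 3" "x(n := 0, n := a) \<in> U"
    using * unfolding meets_lines_def by blast
  then show "x \<in> shadow n U" using * by (auto simp: shadow_def)
qed (auto simp: shadow_def)

lemma card_unitrade_meets_lines:
  assumes "unitrade (Suc n) U" "meets_lines (Suc n) U"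
  shows "card U = 2 * 3 ^ n"
  using card_unitrade_shadow[OF assms(1)] shadow_meets_lines[OF assms(2)] by simp

text \<open>Equality in the upper bound forces equality in each of the three layers, which settles
  the lines inside layers by induction. It also forces the shadow to be everything, which settles
  the lines in the last direction.\<close>

lemma meets_lines_max:
  assumes "unitrade (Suc n) U" "card U = 2 * 3 ^ n"
  shows "meets_lines (Suc n) U"
  using assms
proof (induction n arbitrary: U)
  \<comment> \<open>\<open>Q 3 1\<close> is a single line, so any point of \<open>U\<close> will
    do.\<close>
  case 0
  have "card U \<noteq> 0" using 0 by simp
  then obtain y where "y \<in> U" by fastforce
  then have y: "y \<in> Q 3 1" "y \<in> U" using unitrade_subset[OF 0(1)] by auto
  have "x(0 := y 0) = y" if "x \<in> Q 3 1" for x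
    using that y by (intro Q_eqI[of _ 3 1] Q_upd) (auto intro: Q_less)
  then show ?case using y Q_less[of y 3 1 0] by (auto simp: meets_lines_def intro!: exI[of _ "y 0"])
next
  case (Suc n)
  have le: "card (layer (Suc n) U t) \<le> 2 * 3 ^ n" if "t < 3" for t
    using Suc.prems(1) that by (intro card_unitrade_le unitrade_layer)
  have "card (layer (Suc n) U t) = 2 * 3 ^ n" if "t < 3" for t
    using le[of 0] le[of 1] le[of 2] that Suc.prems(2)
      card_layers[OF unitrade_subset[OF Suc.prems(1)]]
    by (auto simp: less_3_iff)
  then have layer: "meets_lines (Suc n) (layer (Suc n) U t)" if "t < 3" for t
    using that by (intro Suc.IH unitrade_layer[OF Suc.prems(1)])
  have "card (shadow (Suc n) U) = card (Q 3 (Suc n))"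
    using card_unitrade_shadow[OF Suc.prems(1)] Suc.prems(2) by simp
  then have shadow: "shadow (Suc n) U = Q 3 (Suc n)"
    by (intro card_subset_eq) (auto simp: shadow_def)
  show ?case unfolding meets_lines_def
  proof (intro ballI allI impI)
    fix x i assume x: "x \<in> Q 3 (Suc (Suc n))" "i < Suc (Suc n)"
    obtain y t where y: "y \<in> Q 3 (Suc n)" "t < 3" "x = y(Suc n := t)"
      using x(1) by (rule Q_SucE)
    show "\<exists>a<3. x(i := a) \<in> U"
    proof (cases "i = Suc n")
      case True
      then show ?thesis using y shadow by (auto simp: shadow_def)
    next
      case False
      then have i: "i < Suc n" using x by simp
      then obtain a where "a < 3" "y(i := a) \<in> layer (Suc n) U t"
        using y layer[of t] unfolding meets_lines_def by blast
      then show ?thesis using y i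
        by (auto simp add: fun_upd_twist[of i "Suc n"] simp del: fun_upd_apply)
    qed
  qed
qed

section \<open>Latin hypercubes\<close>

definition latin :: "nat \<Rightarrow> (nat \<Rightarrow> nat) set \<Rightarrow> bool" where
  "latin n P \<longleftrightarrow> P \<subseteq> Q 3 n \<and> (\<forall>x\<in>Q 3 n. \<forall>i<n. \<exists>!a. a < 3 \<and> x(i := a) \<in> P)"

lemma latin_compl:
  assumes "unitrade n U" "meets_lines n U"
  shows "latin n (Q 3 n - U)"
  unfolding latin_def
proof (intro conjI ballI allI impI)
  fix x i assume x: "x \<in> Q 3 n" "i < n"
  then obtain a where "a < 3" "x(i := a) \<in> U" using assms by (auto simp: meets_lines_def)
  moreover have "x(i := 2) \<in> U \<longleftrightarrow> (x(i := 0) \<in> U) \<noteq> (x(i := 1) \<in> U)"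
    using assms x by (auto simp: unitrade_iff)
  ultimately have "\<exists>!a. a < 3 \<and> x(i := a) \<notin> U"
    unfolding less_3_iff Ex1_def by (auto simp del: fun_upd_apply)
  then show "\<exists>!a. a < 3 \<and> x(i := a) \<in> Q 3 n - U"
    using x by (simp add: Q_upd cong: conj_cong del: fun_upd_apply)
qed auto

lemma unitrade_compl:
  assumes "latin n P"
  shows "unitrade n (Q 3 n - P)" "meets_lines n (Q 3 n - P)"
proof -
  have "(x(i := 2) \<in> Q 3 n - P \<longleftrightarrow> (x(i := 0) \<in> Q 3 n - P) \<noteq> (x(i := 1) \<in> Q 3 n - P)) \<and>
      (\<exists>a<3. x(i := a) \<in> Q 3 n - P)" if "x \<in> Q 3 n" "i < n" for x i
  proof -
    have "\<exists>!a. a < 3 \<and> x(i := a) \<in> P" using assms that by (auto simp: latin_def)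
    then obtain a where a: "a < 3" "x(i := a) \<in> P" "\<And>b. b < 3 \<Longrightarrow> x(i := b) \<in> P \<Longrightarrow> b = a"
      by blast
    have *: "x(i := b) \<in> Q 3 n - P \<longleftrightarrow> b \<noteq> a" if "b < 3" for b
      using a(2) a(3)[OF that] Q_upd[OF \<open>x \<in> Q 3 n\<close> \<open>i < n\<close> that] by blast
    consider "a = 0" | "a = 1" | "a = 2" using a(1) by (auto simp: less_3_iff)
    then show ?thesis
    proof cases
      case 1
      then show ?thesis using *[of 0] *[of 1] *[of 2] by (intro conjI exI[of _ 1]) simp_all
    next
      case 2
      then show ?thesis using *[of 0] *[of 1] *[of 2] by (intro conjI exI[of _ 0]) simp_all
    next
      case 3
      then show ?thesis using *[of 0] *[of 1] *[of 2] by (intro conjI exI[of _ 0]) simp_all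
    qed
  qed
  then show "unitrade n (Q 3 n - P)" "meets_lines n (Q 3 n - P)"
    by (auto simp: unitrade_iff meets_lines_def simp del: fun_upd_apply)
qed

lemma latin_line:
  assumes "latin n P" "x \<in> Q 3 n" "i < n"
  obtains a where "a < 3" "x(i := a) \<in> P"
  using assms unfolding latin_def by blast

lemma latin_unique:
  assumes "latin n P" "x \<in> Q 3 n" "i < n" "a < 3" "b < 3" "x(i := a) \<in> P" "x(i := b) \<in> P"
  shows "a = b"
  using assms unfolding latin_def by blast

lemma latin_subset: "latin n P \<Longrightarrow> P \<subseteq> Q 3 n"
  by (simp add: latin_def)

lemma layer_compl: "t < 3 \<Longrightarrow> layer n (Q 3 (Suc n) - P) t = Q 3 n - layer n P t"
  by (auto intro: Q_upd_last simp del: fun_upd_apply)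

lemma latin_layer:
  assumes "latin (Suc n) P" "t < 3"
  shows "latin n (layer n P t)"
proof -
  have "latin n (Q 3 n - layer n (Q 3 (Suc n) - P) t)"
    using unitrade_compl[OF assms(1)] assms(2)
    by (intro latin_compl unitrade_layer meets_lines_layer)
  moreover have "Q 3 n - layer n (Q 3 (Suc n) - P) t = layer n P t"
    using layer_subset by (auto simp: layer_compl[OF assms(2)] simp del: mem_layer)
  ultimately show ?thesis by simp
qed

lemma layer_disjoint:
  assumes "latin (Suc n) P" "k < 3" "l < 3" "k \<noteq> l"
  shows "layer n P k \<inter> layer n P l = {}"
proof -
  have "k = l" if "y \<in> layer n P k" "y \<in> layer n P l" for y
  proof (rule latin_unique[OF assms(1) _ lessI assms(2,3)])
    show "y(n := 0) \<in> Q 3 (Suc n)" using that by (intro Q_upd_last) auto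
  qed (use that in \<open>simp_all del: fun_upd_apply\<close>)
  then show ?thesis using assms(4) by blast
qed

lemma card_latin:
  assumes "latin (Suc n) P"
  shows "card P = 3 ^ n"
proof -
  have "card (Q 3 (Suc n) - P) = 2 * 3 ^ n"
    using unitrade_compl[OF assms] by (rule card_unitrade_meets_lines)
  moreover have "card (Q 3 (Suc n) - P) = 3 ^ Suc n - card P"
    using latin_subset[OF assms] by (subst card_Diff_subset) (auto intro: finite_subset)
  moreover have "card P \<le> 3 ^ Suc n"
    using card_mono[OF finite_Q latin_subset[OF assms]] by simp
  ultimately show ?thesis by simp
qed

lemma layers_eqI:
  assumes "A \<subseteq> Q 3 (Suc n)" "B \<subseteq> Q 3 (Suc n)" "\<And>t. t < 3 \<Longrightarrow> layer n A t = layer n B t"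
  shows "A = B"
proof -
  have "x \<in> A \<longleftrightarrow> x \<in> B" if x: "x \<in> Q 3 (Suc n)" for x
  proof -
    obtain y t where "y \<in> Q 3 n" "t < 3" "x = y(n := t)"
      using x by (rule Q_SucE)
    then show ?thesis using assms(3)[of t] by (auto simp: set_eq_iff simp del: fun_upd_apply)
  qed
  then show ?thesis using assms(1,2) by blast
qed

lemma third_index:
  assumes "a < 3" "b < 3" "a \<noteq> b"
  obtains c :: nat where "c < 3" "c \<noteq> a" "c \<noteq> b" "\<forall>t<3. t = a \<or> t = b \<or> t = c"
proof (rule that[of "3 - a - b"])
  have "a = 0 \<or> a = 1 \<or> a = 2" "b = 0 \<or> b = 1 \<or> b = 2" using assms by auto
  then show "3 - a - b < 3" "3 - a - b \<noteq> a" "3 - a - b \<noteq> b"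
      "\<forall>t<3. t = a \<or> t = b \<or> t = 3 - a - b"
    using assms(3) by (elim disjE; force)+
qed

text \<open>By induction each layer of \<open>T\<close> is empty or equal to that of
  \<open>A\<close>. A full layer \<open>a\<close> next to an empty layer \<open>b\<close> is
  impossible: some line in the last direction misses \<open>A\<close> in the third layer
  \<open>c\<close>, hence meets \<open>A\<close> exactly at \<open>a\<close> and \<open>b\<close>,
  and would meet \<open>T\<close> only at \<open>a\<close>.\<close>

lemma unitrade_minimal:
  assumes "unitrade (Suc n) A" "meets_lines (Suc n) A" "unitrade (Suc n) T" "T \<subseteq> A"
  shows "T = {} \<or> T = A"
  using assms
proof (induction n arbitrary: A T)
  case 0
  have "finite A" using unitrade_subset[OF "0.prems"(1)] by (rule finite_subset) simp
  moreover have "card A = 2" using card_unitrade_meets_lines[OF "0.prems"(1,2)] by simp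
  moreover have "card T = 2 * card (shadow 0 T)" by (rule card_unitrade_shadow[OF "0.prems"(3)])
  ultimately show ?case
    using "0.prems"(4) card_subset_eq[of A T] card_mono[of A T] finite_subset[of T A]
    by (cases "card (shadow 0 T)") auto
next
  case (Suc n)
  note A = Suc.prems(1,2) and T = Suc.prems(3,4)
  let ?m = "Suc n"
  have layers: "layer ?m T t = {} \<or> layer ?m T t = layer ?m A t" if "t < 3" for t
    using A T that by (intro Suc.IH unitrade_layer meets_lines_layer) auto
  have step: "layer ?m T b = layer ?m A b"
    if ab: "a < 3" "b < 3" "a \<noteq> b" "layer ?m T a \<noteq> {}" for a b
  proof (rule ccontr)
    assume "layer ?m T b \<noteq> layer ?m A b"
    then have b: "layer ?m T b = {}" using layers that by blast
    have a: "layer ?m T a = layer ?m A a" using layers that by blast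
    obtain c where c: "c < 3" "c \<noteq> a" "c \<noteq> b" "\<forall>t<3. t = a \<or> t = b \<or> t = c"
      using ab(1-3) by (rule third_index)
    \<comment> \<open>The complement of layer \<open>c\<close> is a Latin hypercube, hence has
      \<open>3 ^ n\<close> points and is not empty; this supplies the line that avoids
      \<open>A\<close> at \<open>c\<close>.\<close>
    have "latin ?m (Q 3 ?m - layer ?m A c)"
      using A c by (intro latin_compl unitrade_layer meets_lines_layer)
    then have "card (Q 3 ?m - layer ?m A c) \<noteq> 0" by (simp add: card_latin)
    then have "Q 3 ?m - layer ?m A c \<noteq> {}" by fastforce
    then obtain y where y: "y \<in> Q 3 ?m" "y(?m := c) \<notin> A"
      using mem_layer by blast
    have y0: "y(?m := 0) \<in> Q 3 (Suc ?m)" using y by (intro Q_upd_last) auto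
    obtain d where "d < 3" "y(?m := d) \<in> A"
      using A(2) y0 unfolding meets_lines_def by (metis fun_upd_upd lessI)
    then have "y(?m := a) \<in> A \<or> y(?m := b) \<in> A" using c y by metis
    moreover have "y(?m := c) \<in> A \<longleftrightarrow> (y(?m := a) \<in> A) \<noteq> (y(?m := b) \<in> A)"
      using unitrade_line[OF A(1) y0, of ?m c a b] c that by simp
    ultimately have "y(?m := a) \<in> T" using y a mem_layer[of y ?m] by blast
    moreover have "y(?m := c) \<in> T \<longleftrightarrow> (y(?m := a) \<in> T) \<noteq> (y(?m := b) \<in> T)"
      using unitrade_line[OF T(1) y0, of ?m c a b] c that by simp
    ultimately show False using b y T(2) mem_layer[of y ?m T b] by blast
  qed
  show ?case
  proof (cases "\<exists>a<3. layer ?m T a \<noteq> {}")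
    case True
    then obtain a where a: "a < 3" "layer ?m T a \<noteq> {}" by blast
    have "layer ?m T t = layer ?m A t" if "t < 3" for t
      using a that layers[of a] step[of a t] by (cases "t = a") blast+
    then have "T = A"
      by (rule layers_eqI[OF unitrade_subset[OF T(1)] unitrade_subset[OF A(1)]])
    then show ?thesis ..
  next
    case False
    then have "layer ?m T t = layer ?m {} t" if "t < 3" for t using that by auto
    then have "T = {}" by (rule layers_eqI[OF unitrade_subset[OF T(1)] empty_subsetI])
    then show ?thesis ..
  qed
qed

section \<open>The gap below the maximum\<close>

text \<open>Adjacent words are two values of one update \<open>x(i := _)\<close>, so a bipartition
  is a proper colouring \<open>K\<close> by truth values. Stated with updates, it restricts to
  layers and can be followed along explicit walks.\<close>

lemma induces_bipartite_iff:
  assumes "U \<subseteq> Q 3 n"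
  shows "induces_bipartite n U \<longleftrightarrow>
    (\<exists>K :: (nat \<Rightarrow> nat) \<Rightarrow> bool. \<forall>x. \<forall>i<n. \<forall>a b. a \<noteq> b \<longrightarrow> x(i := a) \<in> U \<longrightarrow> x(i := b) \<in> U \<longrightarrow>
      K (x(i := a)) \<noteq> K (x(i := b)))"
    (is "_ \<longleftrightarrow> (\<exists>K. ?proper K)")
proof
  assume "induces_bipartite n U"
  then obtain V W where VW: "V \<union> W = U" "V \<inter> W = {}"
    "\<forall>x\<in>V. \<forall>y\<in>V. \<not> hamming_adj n x y" "\<forall>x\<in>W. \<forall>y\<in>W. \<not> hamming_adj n x y"
    by (auto simp: induces_bipartite_def)
  have "hamming_adj n (x(i := a)) (x(i := b))" if "i < n" "a \<noteq> b" for x i a b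
  proof -
    have "{k. k < n \<and> (x(i := a)) k \<noteq> (x(i := b)) k} = {i}" using that by auto
    then show ?thesis unfolding hamming_adj_def hamming_dist_def by simp
  qed
  note adj = this
  have "(x(i := a) \<in> V) \<noteq> (x(i := b) \<in> V)"
    if "i < n" "a \<noteq> b" "x(i := a) \<in> U" "x(i := b) \<in> U" for x i a b
  proof -
    have "x(i := a) \<in> V \<or> x(i := a) \<in> W" "x(i := b) \<in> V \<or> x(i := b) \<in> W"
      using that(3,4) VW(1) by blast+
    then show ?thesis using adj[OF that(1,2), of x] VW(3,4) by blast
  qed
  then show "\<exists>K. ?proper K" by (intro exI[of _ "\<lambda>x. x \<in> V"] allI impI)
next
  assume "\<exists>K. ?proper K"
  then obtain K where K: "?proper K" by blast
  have "K x \<noteq> K y" if xy: "x \<in> U" "y \<in> U" "hamming_adj n x y" for x y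
  proof -
    obtain i where i: "{k. k < n \<and> x k \<noteq> y k} = {i}"
      using xy(3) unfolding hamming_adj_def hamming_dist_def by (elim card_1_singletonE)
    then have "i < n" "x i \<noteq> y i" "\<And>k. k < n \<Longrightarrow> k \<noteq> i \<Longrightarrow> x k = y k" by blast+
    moreover have "y \<in> Q 3 n" "x \<in> Q 3 n" using xy assms by auto
    ultimately have "y = x(i := y i)"
      by (intro Q_eqI[of y 3 n] Q_upd) (auto intro: Q_less)
    moreover have "x = x(i := x i)" by simp
    ultimately show ?thesis using K xy(1,2) \<open>i < n\<close> \<open>x i \<noteq> y i\<close> by metis
  qed
  then have "\<forall>x\<in>{x \<in> U. K x}. \<forall>y\<in>{x \<in> U. K x}. \<not> hamming_adj n x y"
    "\<forall>x\<in>{x \<in> U. \<not> K x}. \<forall>y\<in>{x \<in> U. \<not> K x}. \<not> hamming_adj n x y" by blast+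
  then show "induces_bipartite n U" unfolding induces_bipartite_def
    by (intro exI[of _ "{x \<in> U. K x}"] exI[of _ "{x \<in> U. \<not> K x}"]) blast
qed

lemma bitrade_layer:
  assumes "bitrade (Suc n) U" "t < 3"
  shows "bitrade n (layer n U t)"
proof -
  have U: "unitrade (Suc n) U" "induces_bipartite (Suc n) U"
    using assms by (auto simp: bitrade_def)
  then obtain K :: "_ \<Rightarrow> bool" where K: "\<forall>x. \<forall>i<Suc n. \<forall>a b. a \<noteq> b \<longrightarrow>
      x(i := a) \<in> U \<longrightarrow> x(i := b) \<in> U \<longrightarrow> K (x(i := a)) \<noteq> K (x(i := b))"
    unfolding induces_bipartite_iff[OF unitrade_subset[OF U(1)]] by (elim exE)
  have "K (x(i := a, n := t)) \<noteq> K (x(i := b, n := t))"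
    if "i < n" "a \<noteq> b" "x(i := a) \<in> layer n U t" "x(i := b) \<in> layer n U t" for x i a b
    using that K[rule_format, of i a b "x(n := t)"]
    by (simp add: fun_upd_twist[of i n] del: fun_upd_apply)
  then have "induces_bipartite n (layer n U t)"
    unfolding induces_bipartite_iff[OF layer_subset] by (intro exI[of _ "\<lambda>x. K (x(n := t))"] allI impI)
  then show ?thesis using U(1) assms(2) by (simp add: bitrade_def unitrade_layer)
qed

text \<open>Two points of \<open>S\<close> that differ in exactly two coordinates force the third point of the Latin
  hypercube \<open>P\<close> in the same two-dimensional face.\<close>

definition face_closed :: "nat \<Rightarrow> (nat \<Rightarrow> nat) set \<Rightarrow> (nat \<Rightarrow> nat) set \<Rightarrow> bool" where
  "face_closed n P S \<longleftrightarrow> (\<forall>w\<in>Q 3 n. \<forall>i<n. \<forall>j<n. i \<noteq> j \<longrightarrow>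
     (\<forall>a<3. \<forall>b<3. \<forall>c<3. \<forall>d<3. \<forall>e<3. \<forall>f<3.
        a \<noteq> b \<longrightarrow> a \<noteq> c \<longrightarrow> b \<noteq> c \<longrightarrow> d \<noteq> e \<longrightarrow> d \<noteq> f \<longrightarrow> e \<noteq> f \<longrightarrow>
        w(i := a, j := d) \<in> S \<longrightarrow> w(i := b, j := e) \<in> S \<longrightarrow> w(i := c, j := f) \<in> P \<longrightarrow>
        w(i := c, j := f) \<in> S))"

lemma face_closedD:
  assumes "face_closed n P S" "w \<in> Q 3 n" "i < n" "j < n" "i \<noteq> j"
    and "a < 3" "b < 3" "c < 3" "d < 3" "e < 3" "f < 3"
    and "a \<noteq> b" "a \<noteq> c" "b \<noteq> c" "d \<noteq> e" "d \<noteq> f" "e \<noteq> f"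
    and "w(i := a, j := d) \<in> S" "w(i := b, j := e) \<in> S" "w(i := c, j := f) \<in> P"
  shows "w(i := c, j := f) \<in> S"
  using assms(1)[unfolded face_closed_def, rule_format, OF assms(2-)] .

lemma face_closed_layer:
  assumes "face_closed (Suc n) P S" "t < 3"
  shows "face_closed n (layer n P t) (layer n S t)"
  unfolding face_closed_def
proof (intro ballI allI impI)
  fix w i j a b c d e f
  assume w: "w \<in> Q 3 n" "i < n" "j < n" "i \<noteq> j"
    and *: "a < 3" "b < 3" "c < 3" "d < 3" "e < 3" "f < 3"
      "a \<noteq> b" "a \<noteq> c" "b \<noteq> c" "d \<noteq> e" "d \<noteq> f" "e \<noteq> f"
    and mem: "w(i := a, j := d) \<in> layer n S t" "w(i := b, j := e) \<in> layer n S t"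
      "w(i := c, j := f) \<in> layer n P t"
  have twist: "w(i := k, j := l, n := t) = w(n := t, i := k, j := l)" for k l
    using w by (simp add: fun_upd_twist)
  have "w(n := t, i := c, j := f) \<in> S"
    by (rule face_closedD[OF assms(1), OF Q_upd_last[OF w(1) assms(2)] _ _ w(4) *])
      (use w mem in \<open>simp_all del: fun_upd_apply add: twist\<close>)
  then show "w(i := c, j := f) \<in> layer n S t"
    using mem(3) by (simp add: twist del: fun_upd_apply)
qed

text \<open>The parity condition is symmetric in the three letters, so it may be checked in whatever
  order a Latin hypercube assigns them.\<close>

lemma xor_of_line:
  fixes g :: "nat \<Rightarrow> bool"
  assumes "a < 3" "b < 3" "c < 3" "a \<noteq> b" "a \<noteq> c" "b \<noteq> c" "g a \<longleftrightarrow> g b \<noteq> g c"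
  shows "g 2 \<longleftrightarrow> g 0 \<noteq> g 1"
proof -
  have "a = 0 \<or> a = 1 \<or> a = 2" "b = 0 \<or> b = 1 \<or> b = 2" "c = 0 \<or> c = 1 \<or> c = 2"
    using assms(1-3) by auto
  then show ?thesis using assms(4-) by (elim disjE; hypsubst; blast)
qed

text \<open>On a line in direction \<open>i\<close>, the layers \<open>t\<close>, \<open>s\<close>,
  \<open>r\<close> of \<open>P\<close> have one point each, at distinct letters \<open>a\<close>,
  \<open>b\<close>, \<open>c\<close>. The one at \<open>a\<close> is in neither union member. In the
  face spanned by \<open>i\<close> and the last direction, the full layer \<open>t\<close> puts the
  point over \<open>a\<close> into \<open>S\<close>, so closedness carries membership from the point
  over \<open>b\<close> to the one over \<open>c\<close> and back: the line holds 0 or 2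
  points.\<close>

lemma face_closed_unitrade:
  assumes P: "latin (Suc n) P" and S: "S \<subseteq> P" "face_closed (Suc n) P S"
    and t: "layer n S t = layer n P t" and str: "s < 3" "t < 3" "r < 3" "s \<noteq> t" "s \<noteq> r" "t \<noteq> r"
  shows "unitrade n (layer n S s \<union> layer n S r)"
  unfolding unitrade_iff
proof (intro conjI ballI allI impI)
  show "layer n S s \<union> layer n S r \<subseteq> Q 3 n" by (auto simp: layer_def)
  fix x i assume x: "x \<in> Q 3 n" "i < n"
  have ex: "\<exists>a<3. x(i := a) \<in> layer n P k" if "k < 3" for k
    using latin_layer[OF P that] x by (auto elim!: latin_line simp del: mem_layer)
  obtain a b c where abc: "a < 3" "b < 3" "c < 3"
      "x(i := a) \<in> layer n P t" "x(i := b) \<in> layer n P s" "x(i := c) \<in> layer n P r"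
    using ex[OF str(1)] ex[OF str(2)] ex[OF str(3)] by auto
  have disj: "k = l" if "k < 3" "l < 3" "y \<in> layer n P k" "y \<in> layer n P l" for k l y
    using layer_disjoint[OF P that(1,2)] that(3,4) by blast
  have ne: "a \<noteq> b" "a \<noteq> c" "b \<noteq> c"
    using disj abc str by metis+
  have sub: "layer n S k \<subseteq> layer n P k" for k using S(1) by auto
  have notin: "x(i := a) \<notin> layer n S s" "x(i := a) \<notin> layer n S r"
      "x(i := b) \<notin> layer n S r" "x(i := c) \<notin> layer n S s"
    using disj abc str sub by blast+
  have x0: "x(n := 0) \<in> Q 3 (Suc n)" using x by (intro Q_upd_last) auto
  have i: "i < Suc n" "n < Suc n" "i \<noteq> n" using x by auto
  have upd: "x(i := k) \<in> layer n V l \<longleftrightarrow> x(n := 0, i := k, n := l) \<in> V" if "k < 3" for k l V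
    using that x by (simp add: Q_upd fun_upd_twist[of i n] del: fun_upd_apply)
  have "x(i := c) \<in> layer n S r" if "x(i := b) \<in> layer n S s"
    using face_closedD[OF S(2) x0 i abc(1,2,3) str(2,1,3)] ne str abc that t
    unfolding upd[OF abc(1), symmetric] upd[OF abc(2), symmetric] upd[OF abc(3), symmetric] by blast
  moreover have "x(i := b) \<in> layer n S s" if "x(i := c) \<in> layer n S r"
    using face_closedD[OF S(2) x0 i abc(1,3,2) str(2,3,1)] ne str abc that t
    unfolding upd[OF abc(1), symmetric] upd[OF abc(2), symmetric] upd[OF abc(3), symmetric] by blast
  ultimately have "x(i := a) \<in> layer n S s \<union> layer n S r \<longleftrightarrow>
      (x(i := b) \<in> layer n S s \<union> layer n S r) \<noteq> (x(i := c) \<in> layer n S s \<union> layer n S r)"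
    using notin by blast
  then show "x(i := 2) \<in> layer n S s \<union> layer n S r \<longleftrightarrow>
      (x(i := 0) \<in> layer n S s \<union> layer n S r) \<noteq> (x(i := 1) \<in> layer n S s \<union> layer n S r)"
    by (rule xor_of_line[OF abc(1-3) ne])
qed

lemma latin_layers_Un:
  assumes "latin (Suc n) P" and str: "s < 3" "t < 3" "r < 3" "s \<noteq> t" "s \<noteq> r" "t \<noteq> r"
  shows "layer n P s \<union> layer n P r = Q 3 n - layer n P t"
proof (intro equalityI subsetI)
  fix y assume y: "y \<in> Q 3 n - layer n P t"
  then have "y(n := 0) \<in> Q 3 (Suc n)" by (intro Q_upd_last) auto
  then obtain a where a: "a < 3" "y(n := 0, n := a) \<in> P" by (rule latin_line[OF assms(1) _ lessI])
  moreover have "a \<noteq> t" using a y by auto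
  then have "a = s \<or> a = r" using a str by linarith
  ultimately show "y \<in> layer n P s \<union> layer n P r" using y by auto
qed (use layer_disjoint[OF assms(1)] str layer_subset in blast)

text \<open>The bound is a third of \<open>card P = 3 ^ n\<close>. Without a full layer it adds up
  from the three layers. With a full layer, either the other two are empty, or they are forced to be
  full by minimality of the maximum unitrade that they make up in \<open>P\<close>.\<close>

lemma face_closed_density:
  assumes "latin (Suc n) P" "S \<subseteq> P" "face_closed (Suc n) P S"
  shows "3 * card S \<le> 3 ^ n \<or> S = P"
  using assms
proof (induction n arbitrary: P S)
  case 0
  then have "card P = 1" by (simp add: card_latin)
  then obtain p where "P = {p}" by (elim card_1_singletonE)
  then show ?case using 0(2) by (auto simp: subset_singleton_iff)
next
  case (Suc n)
  note P = Suc.prems(1) and S = Suc.prems(2,3)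
  let ?m = "Suc n"
  have SQ: "S \<subseteq> Q 3 (Suc ?m)" using S(1) latin_subset[OF P] by blast
  have sub: "layer ?m S k \<subseteq> layer ?m P k" for k using S(1) by auto
  have layers: "3 * card (layer ?m S k) \<le> 3 ^ n \<or> layer ?m S k = layer ?m P k" if "k < 3" for k
    by (rule Suc.IH[OF latin_layer[OF P that] sub face_closed_layer[OF S(2) that]])
  show ?case
  proof (cases "\<exists>t<3. layer ?m S t = layer ?m P t")
    case False
    then have "3 * card (layer ?m S k) \<le> 3 ^ n" if "k < 3" for k using layers that by blast
    from this[of 0] this[of 1] this[of 2] show ?thesis using card_layers[OF SQ] by simp
  next
    case True
    then obtain t where t: "t < 3" "layer ?m S t = layer ?m P t" by blast
    show ?thesis
    proof (cases "\<exists>s<3. s \<noteq> t \<and> layer ?m S s \<noteq> {}")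
      \<comment> \<open>One full layer and two empty ones attain the bound with equality.\<close>
      case False
      have "card (layer ?m S k) = (if k = t then 3 ^ n else 0)" if "k < 3" for k
        using False t card_latin[OF latin_layer[OF P t(1)]] that by (cases "k = t") force+
      from this[of 0] this[of 1] this[of 2]
      have "card (layer ?m S 0) = (if 0 = t then 3 ^ n else 0)"
        "card (layer ?m S 1) = (if 1 = t then 3 ^ n else 0)"
        "card (layer ?m S 2) = (if 2 = t then 3 ^ n else 0)" by simp_all
      moreover have "t = 0 \<or> t = 1 \<or> t = 2" using t(1) by auto
      ultimately have "card S = 3 ^ n" using card_layers[OF SQ] by (elim disjE) simp_all
      then show ?thesis by simp
    next
      case True
      then obtain s where s: "s < 3" "s \<noteq> t" "layer ?m S s \<noteq> {}" by blast
      obtain r where r: "r < 3" "r \<noteq> s" "r \<noteq> t" "\<forall>k<3. k = s \<or> k = t \<or> k = r"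
        using s(1) t(1) s(2) by (rule third_index)
      have str: "s < 3" "t < 3" "r < 3" "s \<noteq> t" "s \<noteq> r" "t \<noteq> r" using s t r by auto
      have Un: "layer ?m P s \<union> layer ?m P r = Q 3 ?m - layer ?m P t"
        by (rule latin_layers_Un[OF P str])
      have "layer ?m S s \<union> layer ?m S r = {} \<or>
          layer ?m S s \<union> layer ?m S r = layer ?m P s \<union> layer ?m P r"
        using unitrade_compl[OF latin_layer[OF P t(1)]] face_closed_unitrade[OF P S t(2) str] sub
        unfolding Un[symmetric] by (intro unitrade_minimal) blast+
      then have full: "layer ?m S s \<union> layer ?m S r = layer ?m P s \<union> layer ?m P r"
        using s(3) by blast
      \<comment> \<open>The layers of \<open>P\<close> are disjoint, so equality of the unions
        splits into equality of the two members.\<close>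
      have "layer ?m S s = layer ?m P s" "layer ?m S r = layer ?m P r"
        using full sub[of s] sub[of r] layer_disjoint[OF P s(1) r(1)] r(2) by blast+
      then have "layer ?m S k = layer ?m P k" if "k < 3" for k
        using that r(4) t(2) by blast
      then have "S = P" by (rule layers_eqI[OF SQ latin_subset[OF P]])
      then show ?thesis ..
    qed
  qed
qed

text \<open>Everything takes place in the three-dimensional face spanned by \<open>i\<close>,
  \<open>j\<close> and the last direction \<open>m\<close>. If the line over the third point of
  \<open>P\<close> missed \<open>U\<close>, the parity conditions would force seven points of
  \<open>U\<close> that form an odd cycle.\<close>

lemma bitrade_face_closed:
  assumes U: "bitrade (Suc m) U" and t: "t < 3" and full: "meets_lines m (layer m U t)"
  defines "P \<equiv> Q 3 m - layer m U t"
  shows "face_closed m P (P \<inter> shadow m U)"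
  unfolding face_closed_def
proof (intro ballI allI impI)
  fix w i j a b c d e f
  assume w: "w \<in> Q 3 m" and ij: "i < m" "j < m" "i \<noteq> j"
    and less: "a < 3" "b < 3" "c < 3" "d < 3" "e < 3" "f < 3"
    and ne: "a \<noteq> b" "a \<noteq> c" "b \<noteq> c" "d \<noteq> e" "d \<noteq> f" "e \<noteq> f"
    and x: "w(i := a, j := d) \<in> P \<inter> shadow m U" and y: "w(i := b, j := e) \<in> P \<inter> shadow m U"
    and z: "w(i := c, j := f) \<in> P"
  have uU: "unitrade (Suc m) U" using U by (simp add: bitrade_def)
  have P: "latin m P" unfolding P_def
    by (intro latin_compl unitrade_layer[OF uU t] full)
  \<comment> \<open>\<open>M\<close> is membership in \<open>U\<close> in the coordinates of this
    face, and \<open>L\<close> below is the 2-colouring in the same coordinates. The facts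
    \<open>l1\<close>, \<open>l2\<close>, \<open>l3\<close> and \<open>L1\<close>,
    \<open>L2\<close>, \<open>L3\<close> are the line and colouring conditions in its three
    directions.\<close>
  define M where "M u v k \<longleftrightarrow> w(i := u, j := v, m := k) \<in> U" for u v k
  obtain K :: "_ \<Rightarrow> bool" where K: "\<forall>x. \<forall>i<Suc m. \<forall>a b. a \<noteq> b \<longrightarrow>
      x(i := a) \<in> U \<longrightarrow> x(i := b) \<in> U \<longrightarrow> K (x(i := a)) \<noteq> K (x(i := b))"
    using U unfolding bitrade_def induces_bipartite_iff[OF unitrade_subset[OF uU]] by blast
  define L where "L u v k = K (w(i := u, j := v, m := k))" for u v k
  have wQ: "w(i := u, j := v) \<in> Q 3 m" if "u < 3" "v < 3" for u v
    using w ij that by (intro Q_upd)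
  have wQ': "w(i := u, j := v, m := k) \<in> Q 3 (Suc m)" if "u < 3" "v < 3" "k < 3" for u v k
    using that by (intro Q_upd_last wQ)
  have l1: "M u v k \<longleftrightarrow> M u' v k \<noteq> M u'' v k"
    if "u < 3" "u' < 3" "u'' < 3" "u \<noteq> u'" "u \<noteq> u''" "u' \<noteq> u''" "v < 3" "k < 3" for u u' u'' v k
    using unitrade_line[OF uU wQ'[OF that(1,7,8)], of i u u' u''] ij that
    unfolding M_def by (simp add: fun_upd_twist[of m i] fun_upd_twist[of j i] del: fun_upd_apply)
  have l2: "M u v k \<longleftrightarrow> M u v' k \<noteq> M u v'' k"
    if "v < 3" "v' < 3" "v'' < 3" "v \<noteq> v'" "v \<noteq> v''" "v' \<noteq> v''" "u < 3" "k < 3" for u v v' v'' k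
    using unitrade_line[OF uU wQ'[OF that(7,1,8)], of j v v' v''] ij that
    unfolding M_def by (simp add: fun_upd_twist[of m j] del: fun_upd_apply)
  have l3: "M u v k \<longleftrightarrow> M u v k' \<noteq> M u v k''"
    if "k < 3" "k' < 3" "k'' < 3" "k \<noteq> k'" "k \<noteq> k''" "k' \<noteq> k''" "u < 3" "v < 3" for u v k k' k''
    using unitrade_line[OF uU wQ'[OF that(7,8,1)], of m k k' k''] that
    unfolding M_def by (simp del: fun_upd_apply)
  have L1: "L u v k \<noteq> L u' v k" if "u \<noteq> u'" "M u v k" "M u' v k" for u u' v k
    using K[rule_format, of i u u' "w(j := v, m := k)"] ij that
    unfolding M_def L_def by (simp add: fun_upd_twist[of m i] fun_upd_twist[of j i] del: fun_upd_apply)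
  have L2: "L u v k \<noteq> L u v' k" if "v \<noteq> v'" "M u v k" "M u v' k" for u v v' k
    using K[rule_format, of j v v' "w(i := u, m := k)"] ij that
    unfolding M_def L_def by (simp add: fun_upd_twist[of m j] del: fun_upd_apply)
  have L3: "L u v k \<noteq> L u v k'" if "k \<noteq> k'" "M u v k" "M u v k'" for u v k k'
    using K[rule_format, of m k k' "w(i := u, j := v)"] that
    unfolding M_def L_def by (simp del: fun_upd_apply)
  have MP: "M u v t \<longleftrightarrow> w(i := u, j := v) \<notin> P" if "u < 3" "v < 3" for u v
    using wQ[OF that] by (simp add: M_def P_def del: fun_upd_apply)
  have notin_P: "M u v' t" if "u < 3" "v < 3" "v' < 3" "v \<noteq> v'" "w(i := u, j := v) \<in> P" for u v v'
    using latin_unique[OF P wQ[OF that(1,2)] ij(2) that(2,3)] that MP[OF that(1,3)] by auto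
  show "w(i := c, j := f) \<in> P \<inter> shadow m U"
  proof (rule ccontr)
    assume "w(i := c, j := f) \<notin> P \<inter> shadow m U"
    then have z': "\<not> M c f k" if "k < 3" for k
      using that z wQ[OF less(3,6)] by (auto simp: M_def shadow_def simp del: fun_upd_apply)
    have ae: "M a e t" "M a f t" and b: "M b d t" "M b f t"
      using notin_P less ne x y by (metis IntD1)+
    \<comment> \<open>The line over \<open>(a, e)\<close> meets \<open>U\<close> in layer
      \<open>t\<close>, hence in exactly one further layer, which is called
      \<open>s\<close>.\<close>
    obtain s where s: "s < 3" "s \<noteq> t" "M a e s"
    proof -
      obtain k :: nat where k: "k < 3" "k \<noteq> t"
        using that[of "if t = 0 then 1 else 0"] by simp
      obtain l where "l < 3" "l \<noteq> k" "l \<noteq> t" using k(1) t k(2) by (rule third_index)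
      then show ?thesis using l3[of t k l a e] that[of k] that[of l] k ae t less by blast
    qed
    obtain r where r: "r < 3" "r \<noteq> s" "r \<noteq> t" "\<forall>k<3. k = s \<or> k = t \<or> k = r"
      using s(1) t s(2) by (rule third_index)
    \<comment> \<open>A point of \<open>P\<close> is absent from layer \<open>t\<close>, so if its
      line meets \<open>U\<close> at all, it does so in both other layers.\<close>
    have diag: "M u v s" if uv: "u < 3" "v < 3" "w(i := u, j := v) \<in> P \<inter> shadow m U" for u v
    proof -
      have "\<not> M u v t" using MP that by blast
      moreover obtain k where "k < 3" "M u v k"
        using uv(3) by (auto simp: shadow_def M_def simp del: fun_upd_apply)
      ultimately show ?thesis
        using l3[of t s r u v] r s t that(1,2) by blast
    qed
    have ad: "M a d s" and be: "M b e s" using diag less x y by blast+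
    \<comment> \<open>In layer \<open>s\<close> the points \<open>(a, e)\<close> and
      \<open>(b, e)\<close> exclude \<open>(c, e)\<close>. With \<open>(c, f)\<close> absent by
      assumption this excludes \<open>(c, d)\<close>, and then \<open>(a, d)\<close> forces
      \<open>(b, d)\<close>.\<close>
    have "\<not> M c e s" using l1[of c a b e s] s ad be less ne by blast
    then have "\<not> M c d s" using l2[of d e f c s] z'[OF s(1)] s less ne by blast
    then have bd: "M b d s" using l1[of b a c d s] ad s less ne by blast
    text \<open>A closed walk of length \<open>7\<close> in \<open>U\<close>.\<close>
    have "L a e t \<noteq> L a f t" "L b f t \<noteq> L b d t" "L a d s \<noteq> L a e s"
      using L2 ae b ad s(3) ne by blast+
    moreover have "L a f t \<noteq> L b f t" "L b d s \<noteq> L a d s"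
      using L1 ae b ad bd ne by blast+
    moreover have "L b d t \<noteq> L b d s" "L a e s \<noteq> L a e t"
      using L3 ae b bd s by blast+
    ultimately show False by blast
  qed
qed

text \<open>The threshold is multiplied by 27 so that it makes sense below dimension 3 and the
  induction can start in dimension 1. It grows by the factor 3, the number of layers, so some layer
  exceeds its own threshold and is maximum by induction.\<close>

lemma bitrade_gap:
  assumes "bitrade (Suc n) U" "14 * 3 ^ Suc n < 27 * card U"
  shows "card U = 2 * 3 ^ n"
  using assms
proof (induction n arbitrary: U)
  \<comment> \<open>The size is even and at most 2, and 42 < 27 * \<open>card U\<close> excludes
    0.\<close>
  case 0
  then have "unitrade (Suc 0) U" by (simp add: bitrade_def)
  then have "card U = 2 * card (shadow 0 U)" "card U \<le> 2 * 3 ^ 0"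
    by (rule card_unitrade_shadow card_unitrade_le)+
  then show ?case using 0(2) by simp
next
  case (Suc n)
  let ?m = "Suc n"
  have U: "unitrade (Suc ?m) U" using Suc.prems(1) by (simp add: bitrade_def)
  have "card U = card (layer ?m U 0) + card (layer ?m U 1) + card (layer ?m U 2)"
    by (rule card_layers[OF unitrade_subset[OF U]])
  then have sum: "14 * 3 ^ Suc n + 14 * 3 ^ Suc n + 14 * 3 ^ Suc n <
      27 * card (layer ?m U 0) + 27 * card (layer ?m U 1) + 27 * card (layer ?m U 2)"
    using Suc.prems(2) by simp
  have "\<exists>t<3. 14 * 3 ^ Suc n < 27 * card (layer ?m U t)"
  proof (rule ccontr)
    assume "\<not> ?thesis"
    then have "27 * card (layer ?m U t) \<le> 14 * 3 ^ Suc n" if "t < 3" for t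
      using that by (meson not_less)
    from this[of 0] this[of 1] this[of 2] sum show False by simp
  qed
  then obtain t where t: "t < 3" "14 * 3 ^ Suc n < 27 * card (layer ?m U t)" by blast
  let ?P = "Q 3 ?m - layer ?m U t" and ?S = "(Q 3 ?m - layer ?m U t) \<inter> shadow ?m U"
  have max: "card (layer ?m U t) = 2 * 3 ^ n"
    by (rule Suc.IH[OF bitrade_layer[OF Suc.prems(1) t(1)] t(2)])
  then have full: "meets_lines ?m (layer ?m U t)"
    by (rule meets_lines_max[OF unitrade_layer[OF U t(1)]])
  have P: "latin ?m ?P" by (rule latin_compl[OF unitrade_layer[OF U t(1)] full])
  have "shadow ?m U = layer ?m U t \<union> ?S"
    using t(1) by (auto simp: shadow_def simp del: fun_upd_apply)
  moreover have "layer ?m U t \<inter> ?S = {}" by blast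
  moreover have "finite ?S" by simp
  ultimately have "card (shadow ?m U) = 2 * 3 ^ n + card ?S"
    using max card_Un_disjoint finite_layer by metis
  then have card: "card U = 2 * (2 * 3 ^ n + card ?S)" using card_unitrade_shadow[OF U] by simp
  have "3 * card ?S \<le> 3 ^ n \<or> ?S = ?P"
    by (rule face_closed_density[OF P _ bitrade_face_closed[OF Suc.prems(1) t(1) full]]) blast
  then show ?case
  proof
    \<comment> \<open>Here \<open>27 * card U\<close> is at most 54 * (2 + 1/3) * 3^n = 14 *
      3^(n+2), against the assumption.\<close>
    assume "3 * card ?S \<le> 3 ^ n"
    then show ?case using card Suc.prems(2) by simp
  next
    assume "?S = ?P"
    then show ?case using card card_latin[OF P] by simp
  qed
qed

section \<open>Uniqueness of the maximum unitrade\<close>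

definition affine_set :: "nat \<Rightarrow> (nat \<Rightarrow> nat) \<Rightarrow> nat \<Rightarrow> (nat \<Rightarrow> nat) set" where
  "affine_set n a c = {x \<in> Q 3 n. (\<Sum>i<n. a i * x i) mod 3 = c}"

lemma sum_fun_upd:
  fixes n i v :: nat
  assumes "i < n"
  shows "(\<Sum>k<n. g k ((x(i := v)) k)) = g i v + (\<Sum>k\<in>{..<n} - {i}. g k (x k) :: nat)"
proof -
  have "(\<Sum>k<n. g k ((x(i := v)) k)) = g i v + (\<Sum>k\<in>{..<n} - {i}. g k ((x(i := v)) k))"
    using assms by (subst sum.remove[of _ i]) auto
  also have "(\<Sum>k\<in>{..<n} - {i}. g k ((x(i := v)) k)) = (\<Sum>k\<in>{..<n} - {i}. g k (x k))"
    by (intro sum.cong) auto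
  finally show ?thesis .
qed

lemma sum_fun_upd_last: "(\<Sum>k<Suc n. g k ((x(n := v)) k)) = (\<Sum>k<n. g k (x k)) + (g n v :: nat)"
proof -
  have "(\<Sum>k<n. g k ((x(n := v)) k)) = (\<Sum>k<n. g k (x k))" by (rule sum.cong) auto
  then show ?thesis by simp
qed

lemma add_mod_3_cancel: "(s + k) mod 3 = (t + k) mod 3 \<longleftrightarrow> s mod 3 = t mod (3 :: nat)"
proof
  assume "(s + k) mod 3 = (t + k) mod 3"
  then have "(s + k + 2 * k) mod 3 = (t + k + 2 * k) mod 3" by (rule mod_add_cong) simp
  moreover have "u + k + 2 * k = u + 3 * k" for u by simp
  ultimately show "s mod 3 = t mod 3" by (simp only: mod_mult_self2)
next
  assume "s mod 3 = t mod 3"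
  then show "(s + k) mod 3 = (t + k) mod 3" by (rule mod_add_cong) (rule refl)
qed

text \<open>If the coefficients differ at \<open>j\<close>, the two equations in the unknowns at 0
  and \<open>j\<close>, all other letters being 0, have determinant 1 or -1 and thus a common
  solution. The normalisation at 0 rules out that one equation is the negative of the other on the
  left-hand side.\<close>

lemma disjoint_affine_sets:
  assumes a: "a 0 = 1" "\<And>i. i < n \<Longrightarrow> a i = 1 \<or> a i = 2"
    and b: "b 0 = 1" "\<And>i. i < n \<Longrightarrow> b i = 1 \<or> b i = 2"
    and cd: "c < 3" "d < 3" and disj: "affine_set n a c \<inter> affine_set n b d = {}" and j: "j < n"
  shows "a j = b j"
proof (rule ccontr)
  assume ne: "a j \<noteq> b j"
  then have j0: "j \<noteq> 0" using a b by (metis)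
  define z :: "nat \<Rightarrow> nat" where "z i = (if i < n then 0 else undefined)" for i
  have z: "z \<in> Q 3 n" by (auto simp: Q_def z_def PiE_iff extensional_def)
  have sum: "(\<Sum>i<n. e i * (z(0 := u, j := v)) i) = e j * v + e 0 * u" for e u v
  proof -
    have "(\<Sum>i<n. e i * (z(0 := u, j := v)) i) = e j * v + (\<Sum>i\<in>{..<n} - {j}. e i * (z(0 := u)) i)"
      by (rule sum_fun_upd[OF j])
    also have "(\<Sum>i\<in>{..<n} - {j}. e i * (z(0 := u)) i) = e 0 * u"
      using j j0 by (subst sum.remove[of _ 0]) (auto simp: z_def)
    finally show ?thesis .
  qed
  have aj: "(a j = 1 \<and> b j = 2) \<or> (a j = 2 \<and> b j = 1)" using a(2)[OF j] b(2)[OF j] ne by auto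
  have cd': "c = 0 \<or> c = 1 \<or> c = 2" "d = 0 \<or> d = 1 \<or> d = 2" using cd by auto
  have "\<exists>u<3. \<exists>v<3. (a j * v + u) mod 3 = c \<and> (b j * v + u) mod 3 = d"
  \<comment> \<open>Subtracting the equations gives \<open>v\<close> as d - c or c - d, and then u =
    -(c + d) in both cases; modulo 3 the factor 2 stands for -1.\<close>
  proof (intro exI conjI)
    show "(2 * c + 2 * d) mod 3 < 3" "(if a j = 1 then d + 2 * c else c + 2 * d) mod 3 < 3" by simp_all
    show "(a j * ((if a j = 1 then d + 2 * c else c + 2 * d) mod 3) + (2 * c + 2 * d) mod 3) mod 3 = c"
      "(b j * ((if a j = 1 then d + 2 * c else c + 2 * d) mod 3) + (2 * c + 2 * d) mod 3) mod 3 = d"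
      using aj cd' by (elim disjE conjE; simp)+
  qed
  then obtain u v where uv: "u < 3" "v < 3" "(a j * v + u) mod 3 = c" "(b j * v + u) mod 3 = d"
    by blast
  then have "z(0 := u, j := v) \<in> affine_set n a c \<inter> affine_set n b d"
    using z j a(1) b(1) by (auto simp: affine_set_def sum intro!: Q_upd simp del: fun_upd_apply)
  then show False using disj by blast
qed

lemma layer_affine_set:
  assumes "t < 3" "(d + b * t) mod 3 = c" "d < 3"
  shows "layer n (affine_set (Suc n) (a(n := b)) c) t = affine_set n a d"
proof -
  have "x(n := t) \<in> affine_set (Suc n) (a(n := b)) c \<longleftrightarrow> x \<in> affine_set n a d"
    if "x \<in> Q 3 n" for x
  proof -
    have "(\<Sum>i<Suc n. (a(n := b)) i * (x(n := t)) i) = (\<Sum>i<n. a i * x i) + b * t"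
    proof -
      have "(\<Sum>i<n. (a(n := b)) i * x i) = (\<Sum>i<n. a i * x i)" by (rule sum.cong) auto
      then show ?thesis unfolding sum_fun_upd_last by simp
    qed
    moreover have "(s + b * t) mod 3 = c \<longleftrightarrow> s mod 3 = d" for s
      using add_mod_3_cancel[of s "b * t" d] assms(2,3) by simp
    ultimately show ?thesis
      using that Q_upd_last[OF that assms(1)] by (simp add: affine_set_def del: fun_upd_apply sum.lessThan_Suc)
  qed
  moreover have "affine_set n a d \<subseteq> Q 3 n" by (auto simp: affine_set_def)
  ultimately show ?thesis by (auto simp del: fun_upd_apply)
qed

text \<open>The layers are affine by induction and pairwise disjoint, so with leading coefficient 1
  they share their coefficients. Their constants \<open>C t\<close> are then a permutation of the
  residues, and a permutation of three residues is affine in \<open>t\<close>, which yields the last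
  coefficient.\<close>

lemma latin_affine:
  assumes "latin (Suc n) P"
  shows "\<exists>a c. a 0 = 1 \<and> (\<forall>i<Suc n. a i = 1 \<or> a i = 2) \<and> c < 3 \<and> P = affine_set (Suc n) a c"
  using assms
proof (induction n arbitrary: P)
  case 0
  then have "card P = 1" by (simp add: card_latin)
  then obtain p where p: "P = {p}" by (elim card_1_singletonE)
  then have pQ: "p \<in> Q 3 (Suc 0)" using latin_subset[OF 0] by auto
  have "x = p" if "x \<in> Q 3 (Suc 0)" "x 0 mod 3 = p 0" for x
    using that pQ Q_less[OF that(1), of 0] by (intro Q_eqI[of x 3 1 p]) auto
  then have "P = affine_set (Suc 0) (\<lambda>_. 1) (p 0)"
    using p pQ Q_less[OF pQ, of 0] by (auto simp: affine_set_def)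
  then show ?case using Q_less[OF pQ, of 0] by (intro exI[of _ "\<lambda>_. 1"] exI[of _ "p 0"]) simp
next
  case (Suc n)
  let ?m = "Suc n"
  note P = Suc.prems
  have "\<exists>a c. a 0 = 1 \<and> (\<forall>i<?m. a i = 1 \<or> a i = 2) \<and> c < 3 \<and> layer ?m P t = affine_set ?m a c"
    if "t < 3" for t
    by (rule Suc.IH[OF latin_layer[OF P that]])
  then have "\<forall>t. \<exists>a c. t < 3 \<longrightarrow> a 0 = 1 \<and> (\<forall>i<?m. a i = 1 \<or> a i = 2) \<and> c < 3 \<and>
      layer ?m P t = affine_set ?m a c"
    by blast
  then obtain A C where "\<forall>t. t < 3 \<longrightarrow> A t 0 = 1 \<and> (\<forall>i<?m. A t i = 1 \<or> A t i = 2) \<and>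
      C t < 3 \<and> layer ?m P t = affine_set ?m (A t) (C t)"
    unfolding choice_iff by (elim exE)
  then have A0: "A t 0 = 1" and A12: "i < ?m \<Longrightarrow> A t i = 1 \<or> A t i = 2" and C3: "C t < 3"
    and AC: "layer ?m P t = affine_set ?m (A t) (C t)" if "t < 3" for t i
    using that by blast+
  have "A t i = A 0 i" if t: "t < 3" and i: "i < ?m" for t i
  proof (cases "t = 0")
    case False
    have z: "(0::nat) < 3" by simp
    have "layer ?m P t \<inter> layer ?m P 0 = {}" by (rule layer_disjoint[OF P t z False])
    then have "affine_set ?m (A t) (C t) \<inter> affine_set ?m (A 0) (C 0) = {}"
      unfolding AC[OF t] AC[OF z] .
    then show ?thesis
      using A0[OF t] A12[OF t] A0[OF z] A12[OF z] C3[OF t] C3[OF z] i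
      by (intro disjoint_affine_sets[where a = "A t" and b = "A 0" and c = "C t" and d = "C 0"
          and n = ?m and j = i])
  qed simp
  note eq = this
  have layers: "layer ?m P t = affine_set ?m (A 0) (C t)" if t: "t < 3" for t
  proof -
    have "(\<Sum>i<?m. A t i * x i) = (\<Sum>i<?m. A 0 i * x i)" for x
      by (rule sum.cong[OF refl]) (simp add: eq[OF t])
    then show ?thesis unfolding AC[OF t] affine_set_def by (simp only:)
  qed
  have ne: "C s \<noteq> C t" if "s < 3" "t < 3" "s \<noteq> t" for s t
  proof
    assume "C s = C t"
    then have "layer ?m P s = layer ?m P t" using layers that by simp
    then have "layer ?m P s = {}" using layer_disjoint[OF P that] by blast
    then show False using card_latin[OF latin_layer[OF P that(1)]] by simp
  qed
  \<comment> \<open>This is C 0 - C 1 modulo 3, the value that makes C t + b * t constant; it is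
    nonzero because the constants differ.\<close>
  define b where "b = (C 0 + 2 * C 1) mod 3"
  have C: "C 0 < 3" "C 1 < 3" "C 2 < 3" "C 0 \<noteq> C 1" "C 0 \<noteq> C 2" "C 1 \<noteq> C 2"
    using C3[of 0] C3[of 1] C3[of 2] ne[of 0 1] ne[of 0 2] ne[of 1 2] by simp_all
  have "C 0 = 0 \<or> C 0 = 1 \<or> C 0 = 2" "C 1 = 0 \<or> C 1 = 1 \<or> C 1 = 2" "C 2 = 0 \<or> C 2 = 1 \<or> C 2 = 2"
    using C by auto
  then have b: "(b = 1 \<or> b = 2) \<and> (C 0 + b * 0) mod 3 = C 0 \<and> (C 1 + b * 1) mod 3 = C 0 \<and>
      (C 2 + b * 2) mod 3 = C 0"
    using C(4-6) unfolding b_def by (elim disjE) simp_all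
  have "(C t + b * t) mod 3 = C 0" if "t < 3" for t
  proof -
    have "t = 0 \<or> t = 1 \<or> t = 2" using that by auto
    then show ?thesis using b by (elim disjE) blast+
  qed
  then have "layer ?m P t = layer ?m (affine_set (Suc ?m) ((A 0)(?m := b)) (C 0)) t" if "t < 3" for t
    using layer_affine_set[OF that, of "C t" b "C 0" ?m "A 0"] layers[OF that] C3[OF that] that by simp
  then have "P = affine_set (Suc ?m) ((A 0)(?m := b)) (C 0)"
    by (intro layers_eqI[OF latin_subset[OF P], of "affine_set (Suc ?m) ((A 0)(?m := b)) (C 0)"])
      (auto simp: affine_set_def)
  moreover have "((A 0)(?m := b)) 0 = 1" "C 0 < 3"
      "\<forall>i<Suc ?m. ((A 0)(?m := b)) i = 1 \<or> ((A 0)(?m := b)) i = 2"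
    using A0[of 0] A12[of 0] C3[of 0] b by (auto simp: less_Suc_eq)
  ultimately show ?case by blast
qed

section \<open>From affine equations to isometries\<close>

lemma coordinatewise_isometry:
  assumes "\<And>i. i < n \<Longrightarrow> \<sigma> i ` {..<3} \<subseteq> {..<3}" "\<And>i. i < n \<Longrightarrow> inj_on (\<sigma> i) {..<3}"
  shows "hamming_isometry n (\<lambda>x i. if i < n then \<sigma> i (x i) else undefined)"
    (is "hamming_isometry n ?\<phi>")
proof -
  have eq: "?\<phi> x i = ?\<phi> y i \<longleftrightarrow> x i = y i" if "x \<in> Q 3 n" "y \<in> Q 3 n" "i < n" for x y i
    using that assms(2)[OF that(3)] Q_less by (auto dest: inj_onD)
  have "?\<phi> ` Q 3 n \<subseteq> Q 3 n"
    using assms(1) by (fastforce simp: Q_def PiE_iff extensional_def)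
  moreover have "inj_on ?\<phi> (Q 3 n)"
  proof (rule inj_onI)
    fix x y assume "x \<in> Q 3 n" "y \<in> Q 3 n" "?\<phi> x = ?\<phi> y"
    then show "x = y" using eq by (intro Q_eqI[of x 3 n y]) metis+
  qed
  ultimately have "bij_betw ?\<phi> (Q 3 n) (Q 3 n)"
    by (simp add: bij_betw_def endo_inj_surj)
  moreover have "hamming_dist n (?\<phi> x) (?\<phi> y) = hamming_dist n x y"
    if "x \<in> Q 3 n" "y \<in> Q 3 n" for x y
    unfolding hamming_dist_def using eq[OF that] by (intro arg_cong[of _ _ card]) blast
  ultimately show ?thesis by (simp add: hamming_isometry_def)
qed

lemma equivalent_max_unitrade:
  assumes U: "unitrade (Suc n) U" "card U = 2 * 3 ^ n"
  shows "equivalent (Suc n) U {x \<in> Q 3 (Suc n). (\<Sum>i<Suc n. x i) mod 3 \<noteq> 0}"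
proof -
  let ?N = "Suc n"
  have "latin ?N (Q 3 ?N - U)" by (rule latin_compl[OF U(1) meets_lines_max[OF U]])
  then obtain a c where ac: "a 0 = 1" "\<And>i. i < ?N \<Longrightarrow> a i = 1 \<or> a i = 2" "c < 3"
    "Q 3 ?N - U = affine_set ?N a c"
    using latin_affine by blast
  \<comment> \<open>Scaling by \<open>a i\<close> turns the linear form into the plain sum; adding 2
    * c, which is -c modulo 3, at one coordinate moves its value \<open>c\<close> to 0.\<close>
  define \<sigma> where "\<sigma> i k = (a i * k + (if i = 0 then 2 * c else 0)) mod 3" for i k
  define \<phi> where "\<phi> = (\<lambda>x i. if i < ?N then \<sigma> i (x i) else undefined)"
  have inj: "inj_on (\<sigma> i) {..<3}" if "i < ?N" for i
  proof (rule inj_onI)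
    fix k l assume kl: "k \<in> {..<3}" "l \<in> {..<3}" "\<sigma> i k = \<sigma> i l"
    have "(a i * k) mod 3 = (a i * l) mod 3"
      using kl(3) unfolding \<sigma>_def add_mod_3_cancel .
    then show "k = l" using kl(1,2) ac(2)[OF that] by (auto simp: less_3_iff)
  qed
  have iso: "hamming_isometry ?N \<phi>"
    unfolding \<phi>_def by (rule coordinatewise_isometry[OF _ inj]) (auto simp: \<sigma>_def)
  have "(\<Sum>i<?N. \<phi> x i) mod 3 \<noteq> 0 \<longleftrightarrow> x \<in> U" if x: "x \<in> Q 3 ?N" for x
  proof -
    have "(\<Sum>i<?N. \<phi> x i) mod 3 = (\<Sum>i<?N. a i * x i + (if i = 0 then 2 * c else 0)) mod 3"
      by (subst (1 2) mod_sum_eq[symmetric]) (simp add: \<phi>_def \<sigma>_def)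
    also have "(\<Sum>i<?N. a i * x i + (if i = 0 then 2 * c else 0)) = (\<Sum>i<?N. a i * x i) + 2 * c"
      by (simp add: sum.distrib del: sum.lessThan_Suc)
    finally have "(\<Sum>i<?N. \<phi> x i) mod 3 = ((\<Sum>i<?N. a i * x i) + 2 * c) mod 3" .
    moreover have "(s + 2 * c) mod 3 = 0 \<longleftrightarrow> s mod 3 = c" for s
    proof -
      have "(s + 2 * c) mod 3 = (c + 2 * c) mod 3 \<longleftrightarrow> s mod 3 = c mod 3" by (rule add_mod_3_cancel)
      then show ?thesis using ac(3) by simp
    qed
    moreover have "x \<in> U \<longleftrightarrow> x \<notin> affine_set ?N a c" using x by (simp add: ac(4)[symmetric])
    ultimately show ?thesis using x by (simp add: affine_set_def del: sum.lessThan_Suc)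
  qed
  note mem = this
  have bij: "bij_betw \<phi> (Q 3 ?N) (Q 3 ?N)" using iso by (simp add: hamming_isometry_def)
  have "\<phi> ` U = {x \<in> Q 3 ?N. (\<Sum>i<?N. x i) mod 3 \<noteq> 0}"
  proof (intro equalityI subsetI)
    fix y assume "y \<in> {x \<in> Q 3 ?N. (\<Sum>i<?N. x i) mod 3 \<noteq> 0}"
    moreover from this obtain x where "x \<in> Q 3 ?N" "y = \<phi> x"
      using bij by (auto simp: bij_betw_def)
    ultimately show "y \<in> \<phi> ` U" using mem by blast
  next
    fix y assume "y \<in> \<phi> ` U"
    then show "y \<in> {x \<in> Q 3 ?N. (\<Sum>i<?N. x i) mod 3 \<noteq> 0}"
      using mem unitrade_subset[OF U(1)] bij_betwE[OF bij] by blast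
  qed
  then show ?thesis using iso unfolding equivalent_def by blast
qed

lemma all_less_3: "(\<forall>a<3. P a) \<longleftrightarrow> P 0 \<and> P 1 \<and> P (2 :: nat)"
  by (simp add: numeral_3_eq_3 numeral_2_eq_2 All_less_Suc conj_commute conj_left_commute)

lemma mod_3_cases: "(s :: nat) mod 3 = 0 \<or> s mod 3 = 1 \<or> s mod 3 = 2"
  by presburger

section \<open>The words with nonzero coordinate sum\<close>

abbreviation nonzero_sum :: "nat \<Rightarrow> (nat \<Rightarrow> nat) set" where
  "nonzero_sum n \<equiv> {x \<in> Q 3 n. (\<Sum>i<n. x i) mod 3 \<noteq> 0}"

lemma nonzero_sum_upd:
  assumes "x \<in> Q 3 n" "i < n" "a < 3"
  shows "x(i := a) \<in> nonzero_sum n \<longleftrightarrow> (a + (\<Sum>k\<in>{..<n} - {i}. x k) mod 3) mod 3 \<noteq> 0"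
  using Q_upd[OF assms] sum_fun_upd[OF assms(2), of "\<lambda>_ y. y" x a]
  by (simp add: mod_add_right_eq del: fun_upd_apply)

lemma nonzero_sum_unitrade:
  shows "unitrade n (nonzero_sum n)" "meets_lines n (nonzero_sum n)"
proof -
  have "(x(i := 2) \<in> nonzero_sum n \<longleftrightarrow> (x(i := 0) \<in> nonzero_sum n) \<noteq> (x(i := 1) \<in> nonzero_sum n)) \<and>
      (x(i := 0) \<in> nonzero_sum n \<or> x(i := 1) \<in> nonzero_sum n)" if "x \<in> Q 3 n" "i < n" for x i
    using nonzero_sum_upd[OF that, of 0] nonzero_sum_upd[OF that, of 1]
      nonzero_sum_upd[OF that, of 2] mod_3_cases[of "\<Sum>k\<in>{..<n} - {i}. x k"]
    by (elim disjE) simp_all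
  note * = this
  show "unitrade n (nonzero_sum n)" unfolding unitrade_iff using * by blast
  have "(0::nat) < 3" "(1::nat) < 3" by simp_all
  then show "meets_lines n (nonzero_sum n)" unfolding meets_lines_def using * by blast
qed

text \<open>The residue of the sum, 1 or 2 on this set, is a proper colouring: changing one letter
  changes the residue.\<close>

lemma nonzero_sum_bitrade: "bitrade n (nonzero_sum n)"
proof -
  have "((\<Sum>k<n. (x(i := a)) k) mod 3 = 1) \<noteq> ((\<Sum>k<n. (x(i := b)) k) mod 3 = 1)"
    if i: "i < n" and ab: "a \<noteq> b" "x(i := a) \<in> nonzero_sum n" "x(i := b) \<in> nonzero_sum n" for x i a b
  proof -
    let ?R = "\<Sum>k\<in>{..<n} - {i}. x k"
    have sum: "(\<Sum>k<n. (x(i := v)) k) mod 3 = (v + ?R mod 3) mod 3" for v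
      unfolding sum_fun_upd[OF i, of "\<lambda>_ y. y" x v] by (simp add: mod_add_right_eq)
    have "(a + ?R mod 3) mod 3 \<noteq> 0" "(b + ?R mod 3) mod 3 \<noteq> 0"
      using ab(2,3) unfolding sum[symmetric] by blast+
    moreover have "a < 3" "b < 3" using ab(2,3) i Q_less[of "x(i := a)" 3 n i] Q_less[of "x(i := b)" 3 n i] by auto
    then have "a = 0 \<or> a = 1 \<or> a = 2" "b = 0 \<or> b = 1 \<or> b = 2" by auto
    ultimately show ?thesis unfolding sum using ab(1) mod_3_cases[of ?R]
      by (elim disjE) simp_all
  qed
  then have "induces_bipartite n (nonzero_sum n)"
    by (subst induces_bipartite_iff) (blast, intro exI[of _ "\<lambda>x. (\<Sum>k<n. x k) mod 3 = 1"] allI impI)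
  then show ?thesis using nonzero_sum_unitrade by (simp add: bitrade_def)
qed

section \<open>Bitrades of cardinality \<open>14 * 3 ^ (n - 3)\<close>\<close>

text \<open>A bitrade of cardinality \<open>14\<close> in dimension \<open>3\<close>, given by its layers of sizes \<open>6\<close>, \<open>4\<close>, \<open>4\<close>. It is
  lifted to dimension \<open>n\<close> by substituting \<open>x\<^sub>2 + \<dots> + x\<^sub>n\<^sub>-\<^sub>1 mod 3\<close> for the third coordinate,
  which maps each line onto a line.\<close>

definition trade14 :: "nat \<Rightarrow> nat \<Rightarrow> nat \<Rightarrow> bool" where
  "trade14 l a s \<longleftrightarrow> (if l = 0 then (a + s) mod 3 \<noteq> 0 else if l = 1 then a \<le> 1 \<and> s \<le> 1
     else ((a + s) mod 3 \<noteq> 0) \<noteq> (a \<le> 1 \<and> s \<le> 1))"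

text \<open>Layer 0 is a 6-cycle coloured by the residue of the sum. Layers 1 and 2 are the 4-cycles
  on {0, 1}^2 and {0, 2}^2, coloured by whether the point is on the diagonal, in opposite phases
  because both contain (0, 0).\<close>

definition colour14 :: "nat \<Rightarrow> nat \<Rightarrow> nat \<Rightarrow> bool" where
  "colour14 l a s \<longleftrightarrow> (if l = 0 then (a + s) mod 3 = 1 else (a = s) = (l = 1))"

definition trade14_set :: "nat \<Rightarrow> (nat \<Rightarrow> nat) set" where
  "trade14_set n = {x \<in> Q 3 n. trade14 (x 0) (x 1) ((\<Sum>i=2..<n. x i) mod 3)}"

text \<open>A finite check. In the last clause the offset \<open>s\<close> is the residue of the
  other summands on a line in a direction \<open>i >= 2\<close>.\<close>

lemma trade14_lines:
  "\<forall>a<3. \<forall>s<3. trade14 2 a s \<longleftrightarrow> trade14 0 a s \<noteq> trade14 1 a s"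
  "\<forall>l<3. \<forall>s<3. trade14 l 2 s \<longleftrightarrow> trade14 l 0 s \<noteq> trade14 l 1 s"
  "\<forall>l<3. \<forall>a<3. \<forall>s<3. trade14 l a ((2 + s) mod 3) \<longleftrightarrow>
     trade14 l a ((0 + s) mod 3) \<noteq> trade14 l a ((1 + s) mod 3)"
  by (simp_all add: all_less_3 trade14_def)

lemma colour14_proper:
  "\<forall>k<3. \<forall>l<3. \<forall>a<3. \<forall>s<3. k \<noteq> l \<longrightarrow> trade14 k a s \<longrightarrow> trade14 l a s \<longrightarrow>
     colour14 k a s \<noteq> colour14 l a s"
  "\<forall>a<3. \<forall>b<3. \<forall>l<3. \<forall>s<3. a \<noteq> b \<longrightarrow> trade14 l a s \<longrightarrow> trade14 l b s \<longrightarrow>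
     colour14 l a s \<noteq> colour14 l b s"
  "\<forall>b<3. \<forall>c<3. \<forall>l<3. \<forall>a<3. \<forall>s<3. b \<noteq> c \<longrightarrow> trade14 l a ((b + s) mod 3) \<longrightarrow>
     trade14 l a ((c + s) mod 3) \<longrightarrow> colour14 l a ((b + s) mod 3) \<noteq> colour14 l a ((c + s) mod 3)"
  by (simp_all add: all_less_3 trade14_def colour14_def)

lemma sum_from_2_upd:
  fixes x :: "nat \<Rightarrow> nat"
  shows "i < 2 \<Longrightarrow> (\<Sum>k=2..<n. (x(i := v)) k) = (\<Sum>k=2..<n. x k)"
    and "2 \<le> i \<Longrightarrow> i < n \<Longrightarrow>
      (\<Sum>k=2..<n. (x(i := v)) k) mod 3 = (v + (\<Sum>k\<in>{2..<n} - {i}. x k) mod 3) mod 3"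
proof -
  show "(\<Sum>k=2..<n. (x(i := v)) k) = (\<Sum>k=2..<n. x k)" if "i < 2"
    by (rule sum.cong) (use that in auto)
  assume i: "2 \<le> i" "i < n"
  have "(\<Sum>k=2..<n. (x(i := v)) k) = v + (\<Sum>k\<in>{2..<n} - {i}. (x(i := v)) k)"
    using i by (subst sum.remove[of _ i]) auto
  also have "(\<Sum>k\<in>{2..<n} - {i}. (x(i := v)) k) = (\<Sum>k\<in>{2..<n} - {i}. x k)"
    by (rule sum.cong) auto
  finally show "(\<Sum>k=2..<n. (x(i := v)) k) mod 3 = (v + (\<Sum>k\<in>{2..<n} - {i}. x k) mod 3) mod 3"
    by (simp add: mod_add_right_eq)
qed

lemma trade14_set_bitrade:
  assumes n: "3 \<le> n"
  shows "bitrade n (trade14_set n)"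
proof -
  let ?s = "\<lambda>x. (\<Sum>k=2..<n. x k) mod 3"
  have sub: "trade14_set n \<subseteq> Q 3 n" by (auto simp: trade14_set_def)
  have mem: "x(i := v) \<in> trade14_set n \<longleftrightarrow>
      trade14 ((x(i := v)) 0) ((x(i := v)) 1) (?s (x(i := v)))"
    if "x \<in> Q 3 n" "i < n" "v < 3" for x i v
    using Q_upd[OF that] by (simp add: trade14_set_def del: fun_upd_apply)
  have index: "i = 0 \<or> i = 1 \<or> 2 \<le> i" for i :: nat by linarith
  have less: "x 0 < 3" "x 1 < 3" if "x \<in> Q 3 n" for x
    using that n by (auto intro: Q_less)
  have R: "r mod 3 < 3" for r :: nat by simp
  have "unitrade n (trade14_set n)"
    unfolding unitrade_iff
  proof (intro conjI ballI allI impI sub)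
    fix x i assume x: "x \<in> Q 3 n" "i < n"
    note lines = trade14_lines[rule_format]
    show "x(i := 2) \<in> trade14_set n \<longleftrightarrow> (x(i := 0) \<in> trade14_set n) \<noteq> (x(i := 1) \<in> trade14_set n)"
      using index[of i]
    proof (elim disjE)
      assume i: "i = 0"
      show ?thesis using lines(1)[OF less(2)[OF x(1)] R] x
        by (simp add: mem i sum_from_2_upd(1))
    next
      assume i: "i = 1"
      show ?thesis using lines(2)[OF less(1)[OF x(1)] R] x
        by (simp add: mem i sum_from_2_upd(1))
    next
      assume i: "2 \<le> i"
      have "x(i := v) \<in> trade14_set n \<longleftrightarrow>
          trade14 (x 0) (x 1) ((v + (\<Sum>k\<in>{2..<n} - {i}. x k) mod 3) mod 3)" if "v < 3" for v
        unfolding mem[OF x that] sum_from_2_upd(2)[OF i x(2)] using i by simp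
      from this[of 0] this[of 1] this[of 2] show ?thesis
        using lines(3)[OF less[OF x(1)] R, of "\<Sum>k\<in>{2..<n} - {i}. x k"] by simp
    qed
  qed
  moreover have "colour14 ((x(i := a)) 0) ((x(i := a)) 1) (?s (x(i := a))) \<noteq>
      colour14 ((x(i := b)) 0) ((x(i := b)) 1) (?s (x(i := b)))"
    if i: "i < n" and ab: "a \<noteq> b" "x(i := a) \<in> trade14_set n" "x(i := b) \<in> trade14_set n" for x i a b
  proof -
    have xa: "x(i := a) \<in> Q 3 n" "x(i := b) \<in> Q 3 n" using ab sub by auto
    have abl: "a < 3" "b < 3" using Q_less[OF xa(1) i] Q_less[OF xa(2) i] by auto
    have t: "trade14 ((x(i := a)) 0) ((x(i := a)) 1) (?s (x(i := a)))"
      "trade14 ((x(i := b)) 0) ((x(i := b)) 1) (?s (x(i := b)))"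
      using ab(2,3) by (auto simp: trade14_set_def simp del: fun_upd_apply)
    have l: "(x(i := a)) 0 < 3" "(x(i := a)) 1 < 3" using less[OF xa(1)] by auto
    note proper = colour14_proper[rule_format]
    show ?thesis using index[of i]
    proof (elim disjE)
      assume i: "i = 0"
      show ?thesis using proper(1)[OF abl _ R ab(1), of "x 1"] t l unfolding i
        by (simp add: sum_from_2_upd(1))
    next
      assume i: "i = 1"
      show ?thesis using proper(2)[OF abl _ R ab(1), of "x 0"] t l unfolding i
        by (simp add: sum_from_2_upd(1))
    next
      assume i2: "2 \<le> i"
      show ?thesis using proper(3)[OF abl _ _ R ab(1), of "x 0" "x 1"] t l i2
        unfolding sum_from_2_upd(2)[OF i2 i] by simp
    qed
  qed
  then have "induces_bipartite n (trade14_set n)"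
    unfolding induces_bipartite_iff[OF sub]
    by (intro exI[of _ "\<lambda>x. colour14 (x 0) (x 1) (?s x)"] allI impI)
  ultimately show ?thesis by (simp add: bitrade_def)
qed

lemma sum_Q_first_two:
  "(\<Sum>x\<in>Q 3 (k + 2). g (x 0) (x 1)) = 3 ^ k * (\<Sum>l<3. \<Sum>a<3. g l a :: nat)"
proof (induction k)
  case 0
  show ?case by (simp add: numeral_2_eq_2 sum_Q_Suc Q_0)
next
  case (Suc k)
  have "(\<Sum>x\<in>Q 3 (Suc k + 2). g (x 0) (x 1)) = (\<Sum>x\<in>Q 3 (k + 2). \<Sum>a<3::nat. g (x 0) (x 1))"
    by (simp add: sum_Q_Suc del: sum_constant)
  then show ?case using Suc by (simp add: sum_distrib_left[symmetric])
qed

text \<open>The last coordinate is one of the summands, so it makes the sum run through all residues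
  once, whatever the others are. The remaining n - 3 summands are free, and 14 is the count over
  three coordinates.\<close>

lemma card_trade14_set:
  assumes "3 \<le> n"
  shows "card (trade14_set n) = 14 * 3 ^ (n - 3)"
proof -
  have "n = Suc (n - 3 + 2)" using assms by simp
  then obtain k where k: "n = Suc (k + 2)" by blast
  let ?m = "k + 2"
  define G where "G l a = (\<Sum>s<3. of_bool (trade14 l a s) :: nat)" for l a
  have shift: "(\<Sum>s<3. of_bool (trade14 l a ((r + s) mod 3))) = G l a" for l a r
    unfolding sum_less_3 G_def using mod_3_cases[of r]
    by (subst (1 2 3) mod_add_left_eq[symmetric]) (elim disjE; simp add: numeral_2_eq_2)
  have sub: "trade14_set n \<subseteq> Q 3 n" by (auto simp: trade14_set_def)
  have "card (trade14_set n) = (\<Sum>x\<in>Q 3 ?m. \<Sum>s<3. of_bool (x(?m := s) \<in> trade14_set n))"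
    unfolding card_conv_sum[OF sub] unfolding k sum_Q_Suc by (rule refl)
  also have "\<dots> = (\<Sum>x\<in>Q 3 ?m. G (x 0) (x 1))"
  proof (rule sum.cong[OF refl])
    fix x assume x: "x \<in> Q 3 ?m"
    have "(x(?m := s) \<in> trade14_set n) = trade14 (x 0) (x 1) (((\<Sum>i=2..<?m. x i) + s) mod 3)"
      if "s < 3" for s
    proof -
      have "(\<Sum>i=2..<n. (x(?m := s)) i) = (\<Sum>i=2..<?m. (x(?m := s)) i) + s" by (simp add: k)
      also have "(\<Sum>i=2..<?m. (x(?m := s)) i) = (\<Sum>i=2..<?m. x i)" by (rule sum.cong) auto
      finally show ?thesis using Q_upd_last[OF x that] by (simp add: trade14_set_def k)
    qed
    then show "(\<Sum>s<3. of_bool (x(?m := s) \<in> trade14_set n)) = G (x 0) (x 1)"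
      unfolding shift[of "x 0" "x 1" "\<Sum>i=2..<?m. x i", symmetric] by (intro sum.cong refl) simp
  qed
  also have "\<dots> = 3 ^ k * (\<Sum>l<3. \<Sum>a<3. G l a)" by (rule sum_Q_first_two)
  also have "(\<Sum>l<3. \<Sum>a<3. G l a) = 14"
    by (simp add: G_def sum_less_3 trade14_def)
  finally show ?thesis by (simp add: k)
qed

section \<open>The Boolean function of the maximum unitrade\<close>

text \<open>A Boolean word has 0 or 1 at \<open>i\<close>, and both lie below 2, so the Boolean
  words below \<open>x(i := 2)\<close> split into those below \<open>x(i := 0)\<close> and those
  below \<open>x(i := 1)\<close>.\<close>

lemma U_of_unitrade: "unitrade n (U_of n f)"
  unfolding unitrade_iff
proof (intro conjI ballI allI impI)
  fix x i assume x: "x \<in> Q 3 n" "i < n"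
  define D where "D v = {z \<in> Q 2 n. preceq_word n z (x(i := v))}" for v
  have D: "D v = {z \<in> Q 2 n. preceq (z i) v \<and> (\<forall>j<n. j \<noteq> i \<longrightarrow> preceq (z j) (x j))}" for v
    unfolding D_def preceq_word_def using x(2) by auto
  have "z i = 0 \<or> z i = 1" if "z \<in> Q 2 n" for z
    using Q_less[OF that x(2)] by auto
  then have "D 2 = D 0 \<union> D 1" "D 0 \<inter> D 1 = {}"
    unfolding D by (auto simp: preceq_def)
  moreover have "finite (D v)" for v unfolding D_def by simp
  ultimately have "sum f (D 2) = sum f (D 0) + sum f (D 1)"
    by (simp add: sum.union_disjoint)
  moreover have "x(i := v) \<in> U_of n f \<longleftrightarrow> odd (sum f (D v))" if "v < 3" for v
    using Q_upd[OF x that] unfolding D_def U_of_def by (simp add: odd_iff_mod_2_eq_one del: fun_upd_apply)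
  from this[of 0] this[of 1] this[of 2]
  have "x(i := 0) \<in> U_of n f \<longleftrightarrow> odd (sum f (D 0))" "x(i := 1) \<in> U_of n f \<longleftrightarrow> odd (sum f (D 1))"
    "x(i := 2) \<in> U_of n f \<longleftrightarrow> odd (sum f (D 2))" by simp_all
  ultimately show "x(i := 2) \<in> U_of n f \<longleftrightarrow> (x(i := 0) \<in> U_of n f) \<noteq> (x(i := 1) \<in> U_of n f)"
    by simp
qed (auto simp: U_of_def)

lemma U_of_Boolean:
  assumes "y \<in> Q 2 n"
  shows "y \<in> U_of n f \<longleftrightarrow> odd (f y)"
proof -
  have "{x. x \<in> Q 2 n \<and> preceq_word n x y} = {y}"
  proof (intro equalityI subsetI)
    fix x assume x: "x \<in> {x. x \<in> Q 2 n \<and> preceq_word n x y}"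
    have "x = y"
    proof (rule Q_eqI)
      fix i assume "i < n"
      then show "x i = y i"
        using x Q_less[OF assms, of i] by (auto simp: preceq_word_def preceq_def)
    qed (use x assms in auto)
    then show "x \<in> {y}" by simp
  qed (use assms in \<open>auto simp: preceq_word_def preceq_def\<close>)
  moreover have "y \<in> Q 3 n" using assms Q_mono[of 2 3 n] by auto
  ultimately show ?thesis by (simp add: U_of_def odd_iff_mod_2_eq_one)
qed

text \<open>Induction on the number of letters 2: the parity condition expresses a word through two
  words with one 2 fewer.\<close>

lemma unitrade_eqI:
  assumes U: "unitrade n U" and V: "unitrade n V"
    and eq: "\<And>x. x \<in> Q 2 n \<Longrightarrow> x \<in> U \<longleftrightarrow> x \<in> V"
  shows "U = V"
proof -
  have "x \<in> U \<longleftrightarrow> x \<in> V" if "x \<in> Q 3 n" for x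
    using that
  proof (induction "card {i. i < n \<and> x i = 2}" arbitrary: x)
    case 0
    then have "x i \<noteq> 2" if "i < n" for i using that by auto
    then have "x i < 2" if "i < n" for i using that Q_less[OF 0(2) that] by (simp add: less_Suc_eq numeral_3_eq_3 numeral_2_eq_2)
    then have "x \<in> Q 2 n" using 0(2) by (auto simp: Q_def PiE_iff)
    then show ?case by (rule eq)
  next
    case (Suc k)
    then have "{i. i < n \<and> x i = 2} \<noteq> {}" by force
    then obtain i where i: "i < n" "x i = 2" by blast
    have "x(i := v) \<in> U \<longleftrightarrow> x(i := v) \<in> V" if "v < 2" for v
    proof (rule Suc(1))
      have "{j. j < n \<and> (x(i := v)) j = 2} = {j. j < n \<and> x j = 2} - {i}" using that by auto
      then show "k = card {j. j < n \<and> (x(i := v)) j = 2}" using Suc(2) i by simp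
      show "x(i := v) \<in> Q 3 n" using that by (intro Q_upd Suc i) simp
    qed
    from this[of 0] this[of 1]
    have "x(i := 0) \<in> U \<longleftrightarrow> x(i := 0) \<in> V" "x(i := 1) \<in> U \<longleftrightarrow> x(i := 1) \<in> V" by simp_all
    moreover have "x(i := 2) = x" using i by (metis fun_upd_triv)
    ultimately show ?case
      using unitrade_line[OF U Suc(3) i(1), of 2 0 1] unitrade_line[OF V Suc(3) i(1), of 2 0 1] by simp
  qed
  then show ?thesis using unitrade_subset[OF U] unitrade_subset[OF V] by blast
qed

section \<open>Parities of the numbers of subsets by size modulo 3\<close>

definition subsets_mod_3 :: "'a set \<Rightarrow> nat \<Rightarrow> 'a set set" where
  "subsets_mod_3 W r = {S. S \<subseteq> W \<and> card S mod 3 = r}"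

lemma finite_subsets_mod_3: "finite W \<Longrightarrow> finite (subsets_mod_3 W r)"
  by (simp add: subsets_mod_3_def)

text \<open>Pascal's rule by residues, split by whether the new element is taken;
  \<open>(r + 2) mod 3\<close> is r - 1.\<close>

lemma card_subsets_mod_3_insert:
  assumes W: "finite W" "x \<notin> W" and r: "r < 3"
  shows "card (subsets_mod_3 (insert x W) r) =
    card (subsets_mod_3 W r) + card (subsets_mod_3 W ((r + 2) mod 3))"
proof -
  have card: "card (insert x S) mod 3 = r \<longleftrightarrow> card S mod 3 = (r + 2) mod 3" if "S \<subseteq> W" for S
  proof -
    have "finite S" "x \<notin> S" using that W finite_subset by blast+
    then have "card (insert x S) = card S + 1" by simp
    moreover have "(r + 2 + 1) mod 3 = r" using r by simp
    ultimately show ?thesis using add_mod_3_cancel[of "card S" 1 "r + 2"] by simp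
  qed
  have "subsets_mod_3 (insert x W) r =
      subsets_mod_3 W r \<union> insert x ` subsets_mod_3 W ((r + 2) mod 3)"
  proof (intro equalityI subsetI)
    fix S assume S: "S \<in> subsets_mod_3 (insert x W) r"
    show "S \<in> subsets_mod_3 W r \<union> insert x ` subsets_mod_3 W ((r + 2) mod 3)"
    proof (cases "x \<in> S")
      case True
      then obtain T where T: "S = insert x T" "x \<notin> T" by (rule Set.set_insert)
      then have "T \<subseteq> W" using S by (auto simp: subsets_mod_3_def)
      then have "T \<in> subsets_mod_3 W ((r + 2) mod 3)"
        using S T(1) card[of T] by (simp add: subsets_mod_3_def)
      then show ?thesis using T(1) by blast
    qed (use S in \<open>auto simp: subsets_mod_3_def\<close>)
  qed (auto simp: subsets_mod_3_def card)
  moreover have "subsets_mod_3 W r \<inter> insert x ` subsets_mod_3 W ((r + 2) mod 3) = {}"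
    using W by (auto simp: subsets_mod_3_def)
  moreover have "inj_on (insert x) (subsets_mod_3 W ((r + 2) mod 3))"
  proof (rule inj_onI)
    fix S T assume ST: "S \<in> subsets_mod_3 W ((r + 2) mod 3)" "T \<in> subsets_mod_3 W ((r + 2) mod 3)"
      and eq: "insert x S = insert x T"
    have "x \<notin> S" "x \<notin> T" using ST W(2) unfolding subsets_mod_3_def by blast+
    from insert_ident[OF this] show "S = T" using eq by (rule iffD1)
  qed
  ultimately show ?thesis
    using W(1) by (simp add: card_Un_disjoint finite_subsets_mod_3 card_image)
qed

text \<open>By Pascal's rule the triples of parities for sizes 1, 2, 3 are 110, 101, 011, and then
  they repeat. The empty set, with 100, lies outside the cycle, hence the exceptions for
  \<open>card W = 0\<close>.\<close>

lemma odd_card_subsets_mod_3: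
  fixes W :: "'a set"
  assumes "finite W"
  shows "(odd (card (subsets_mod_3 W 0)) \<longleftrightarrow> card W = 0 \<or> card W mod 3 \<noteq> 0) \<and>
    (odd (card (subsets_mod_3 W 1)) \<longleftrightarrow> card W \<noteq> 0 \<and> card W mod 3 \<noteq> 2) \<and>
    (odd (card (subsets_mod_3 W 2)) \<longleftrightarrow> card W \<noteq> 0 \<and> card W mod 3 \<noteq> 1)"
  using assms
proof (induction W rule: finite_induct)
  case empty
  have "subsets_mod_3 ({} :: 'a set) r = (if r = 0 then {{}} else {})" for r :: nat
    by (auto simp: subsets_mod_3_def)
  then show ?case by simp
next
  case (insert x W)
  have r: "(0::nat) < 3" "(1::nat) < 3" "(2::nat) < 3" by simp_all
  have "(0 + 2) mod 3 = (2::nat)" "(1 + 2) mod 3 = (0::nat)" "(2 + 2) mod 3 = (1::nat)" by simp_all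
  note rec = card_subsets_mod_3_insert[OF insert(1,2) r(1), unfolded this]
    card_subsets_mod_3_insert[OF insert(1,2) r(2), unfolded this]
    card_subsets_mod_3_insert[OF insert(1,2) r(3), unfolded this]
  have card: "card (insert x W) = Suc (card W)" using insert by simp
  have mod: "Suc (card W) mod 3 = Suc (card W mod 3) mod 3" by (simp add: mod_Suc_eq)
  show ?case
    using insert.IH mod_3_cases[of "card W"] unfolding rec card mod
    by (elim disjE) (cases "card W = 0"; simp)+
qed

text \<open>At a Boolean word with support W, a monomial is 1 exactly when its index set lies in W.
  So \<open>ell\<close> is the parity of the number of subsets of W with size 1 or 2 modulo 3, while
  the coordinate sum is the size of W.\<close>

lemma ell_odd_iff:
  assumes "y \<in> Q 2 n"
  shows "odd (ell n y) \<longleftrightarrow> (\<Sum>i<n. y i) mod 3 \<noteq> 0"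
proof -
  let ?W = "{i. i < n \<and> y i = 1}"
  have y: "y i = (if i \<in> ?W then 1 else 0)" if "i < n" for i
    using Q_less[OF assms that] that by auto
  have W: "finite ?W" "?W \<subseteq> {..<n}" by auto
  have "(\<Sum>i<n. y i) = (\<Sum>i<n. if i \<in> ?W then 1 else 0)"
    by (rule sum.cong[OF refl]) (use y in auto)
  also have "\<dots> = card ?W"
    using W(2) by (simp add: sum.If_cases Int_absorb1 Int_def cong: conj_cong)
  finally have sum: "(\<Sum>i<n. y i) = card ?W" .
  have prod: "(\<Prod>i\<in>S. y i) = of_bool (S \<subseteq> ?W)" if "S \<subseteq> {..<n}" for S
  proof (cases "S \<subseteq> ?W")
    case True
    then have "(\<Prod>i\<in>S. y i) = (\<Prod>i\<in>S. 1)" by (intro prod.cong) auto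
    then show ?thesis using True by simp
  next
    case False
    then obtain i where "i \<in> S" "i \<notin> ?W" by blast
    then have "\<exists>i\<in>S. y i = 0" using y[of i] that by (auto intro!: bexI[of _ i])
    moreover have "finite S" using that by (rule finite_subset) simp
    ultimately show ?thesis using False by simp
  qed
  have nz: "card S mod 3 \<noteq> 0 \<longleftrightarrow> card S mod 3 = 1 \<or> card S mod 3 = 2" for S :: "nat set"
    using mod_3_cases[of "card S"] by auto
  have "(\<Sum>S | S \<subseteq> {..<n} \<and> card S mod 3 \<noteq> 0. \<Prod>i\<in>S. y i) =
      (\<Sum>S | S \<subseteq> {..<n} \<and> card S mod 3 \<noteq> 0. of_bool (S \<subseteq> ?W))"
    by (rule sum.cong[OF refl]) (simp add: prod)
  also have "\<dots> = card ({S. S \<subseteq> {..<n} \<and> card S mod 3 \<noteq> 0} \<inter> {S. S \<subseteq> ?W})"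
    by simp
  also have "{S. S \<subseteq> {..<n} \<and> card S mod 3 \<noteq> 0} \<inter> {S. S \<subseteq> ?W} =
      subsets_mod_3 ?W 1 \<union> subsets_mod_3 ?W 2"
    using W(2) unfolding subsets_mod_3_def nz by blast
  also have "card \<dots> = card (subsets_mod_3 ?W 1) + card (subsets_mod_3 ?W 2)"
    by (rule card_Un_disjoint) (use finite_subsets_mod_3[OF W(1)] in \<open>auto simp: subsets_mod_3_def\<close>)
  finally have ell: "odd (ell n y) \<longleftrightarrow> odd (card (subsets_mod_3 ?W 1) + card (subsets_mod_3 ?W 2))"
    by (simp add: ell_def)
  have odd_sum: "odd (a + b) \<longleftrightarrow> w mod 3 \<noteq> 0"
    if "odd a \<longleftrightarrow> w \<noteq> 0 \<and> w mod 3 \<noteq> 2" "odd b \<longleftrightarrow> w \<noteq> 0 \<and> w mod 3 \<noteq> 1" for a b w :: nat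
    using that mod_3_cases[of w] unfolding odd_add by (elim disjE) (cases "w = 0"; simp)+
  note parity = odd_card_subsets_mod_3[OF W(1), THEN conjunct2]
  show ?thesis unfolding ell sum
    by (rule odd_sum[OF parity[THEN conjunct1] parity[THEN conjunct2]])
qed

lemma nonzero_sum_eq_U_of_ell: "nonzero_sum n = U_of n (ell n)"
proof (rule unitrade_eqI[OF nonzero_sum_unitrade(1) U_of_unitrade])
  fix y assume y: "y \<in> Q 2 n"
  then have "y \<in> Q 3 n" using Q_mono[of 2 3 n] by auto
  then show "y \<in> nonzero_sum n \<longleftrightarrow> y \<in> U_of n (ell n)"
    using U_of_Boolean[OF y] ell_odd_iff[OF y] by simp
qed

theorem mainTheorem3:
  fixes n :: nat
  assumes "n \<ge> 1"
  shows
    "(let B = {x \<in> Q 3 n. (\<Sum>i<n. x i) mod 3 \<noteq> 0} in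
        (\<forall>U. unitrade n U \<longrightarrow> card U \<le> 2 * 3 ^ (n - 1)) \<and>
        unitrade n B \<and> card B = 2 * 3 ^ (n - 1) \<and>
        (\<forall>U. unitrade n U \<and> card U = 2 * 3 ^ (n - 1) \<longrightarrow> equivalent n U B) \<and>
        bitrade n B \<and>
        B = U_of n (ell n))
     \<and> (n \<ge> 3 \<longrightarrow> (\<exists>U. bitrade n U \<and> card U = 14 * 3 ^ (n - 3)))
     \<and> (n \<ge> 3 \<longrightarrow>
         \<not> (\<exists>U. bitrade n U \<and> 14 * 3 ^ (n - 3) < card U \<and> card U < 2 * 3 ^ (n - 1)))"
proof -
  obtain m where m: "n = Suc m" using assms by (cases n) auto
  then have m': "n - 1 = m" by simp
  have "\<forall>U. unitrade n U \<longrightarrow> card U \<le> 2 * 3 ^ m"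
    unfolding m using card_unitrade_le by blast
  moreover have "card (nonzero_sum n) = 2 * 3 ^ m"
    using nonzero_sum_unitrade[of n] card_unitrade_meets_lines unfolding m by blast
  moreover have "\<forall>U. unitrade n U \<and> card U = 2 * 3 ^ m \<longrightarrow> equivalent n U (nonzero_sum n)"
    unfolding m using equivalent_max_unitrade by blast
  moreover have "n \<ge> 3 \<longrightarrow> (\<exists>U. bitrade n U \<and> card U = 14 * 3 ^ (n - 3))"
    using trade14_set_bitrade card_trade14_set by blast
  moreover have "\<not> (14 * 3 ^ (n - 3) < card U \<and> card U < 2 * 3 ^ m)" if "n \<ge> 3" "bitrade n U" for U
  proof
    assume *: "14 * 3 ^ (n - 3) < card U \<and> card U < 2 * 3 ^ m"
    \<comment> \<open>This brings the bound into the scaled form of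
      \<open>bitrade_gap\<close>.\<close>
    have "14 * 3 ^ Suc m = 27 * (14 * 3 ^ (n - 3) :: nat)"
      using \<open>n \<ge> 3\<close> m by (auto simp: le_iff_add power_add)
    then have "card U = 2 * 3 ^ m" using * that(2) m by (intro bitrade_gap) auto
    then show False using * by simp
  qed
  ultimately show ?thesis
    using nonzero_sum_unitrade(1)[of n] nonzero_sum_bitrade[of n] nonzero_sum_eq_U_of_ell[of n]
    unfolding Let_def m' by blast
qed

end
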